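(* Let $k\ge 1$, let $G_k$ be the group of $k$-jets at $0$ of reparametrizations of $(\mathbb{C},0)$, with Lie algebra $\mathfrak{g}_k$. Let $H\subset G_k$ be a generic stabilizer (generic centralizer) of the adjoint action of $G_k$ on $\mathfrak{g}_k$, let $\mathfrak{h}=\mathrm{Lie}(H)$ and $W=N_{G_k}(H)/H$ (the Weyl group of the action). Then: 1. $\mathbb{C}(\mathfrak{g}_k)^{G_k}=\mathbb{C}(\mathfrak{h})^W$; 2. the Weyl group $W$ is finite; 3. $\mathbb{C}[\mathfrak{g}_k]^{G_k}=\mathbb{C}[\mathfrak{h}]^W$; 4. the invariant ring $\mathbb{C}[\mathfrak{g}_k]^{G_k}$ is finitely generated.
   Context: $G_k\subset GL_k(\mathbb{C})$ is the complex algebraic group of all upper triangular $k\times k$ matrices $A(a_1,\dots,a_k)$, $a_1\in\mathbb{C}^*$, $a_2,\dots,a_k\in\mathbb{C}$, with entries $A_{ij}=\sum_{s_1+\cdots+s_i=j,\ s_l\ge 1} a_{s_1}\cdots a_{s_i}$. It corresponds to the group of reparametrizations $t\mapsto a_1t+a_2t^2+\cdots+a_kt^k$ modulo $t^{k+1}$. Generic stabilizer: for the adjoint action, the stabilizer of $x\in\mathfrak{g}_k$ is its centralizer $Z_{G_k}(x)$, with Lie algebra $\mathfrak{z}_{\mathfrak{g}_k}(x)$. $H$ is a generic stabilizer if there is an open dense subset of $\mathfrak{g}_k$ on which all stabilizers $Z_{G_k}(x)$ are $G_k$-conjugate to each other, and $H$ is the stabilizer of one of these points. $\mathbb{C}[X]$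 and $\mathbb{C}(X)$ denote the regular, respectively rational, functions on $X$. $W$ acts on $\mathfrak{h}$ through the adjoint action of $N_{G_k}(H)$. The equalities in items 1 and 3 mean that restriction of functions from $\mathfrak{g}_k$ to $\mathfrak{h}$ induces isomorphisms. *)

theory Defs
  imports
    "HOL-Analysis.Abstract_Topology"
    "HOL-Algebra.Algebra"
    "Jordan_Normal_Form.Matrix"
begin

section \<open>Jet groups\<close>

text \<open>The coefficient of \<open>t^j\<close> in \<open>(a 1 * t + a 2 * t^2 + ...)^i\<close>: a sum over the
  compositions of \<open>j\<close> into \<open>i\<close> positive parts.\<close>

definition jet_coeff :: "(nat \<Rightarrow> complex) \<Rightarrow> nat \<Rightarrow> nat \<Rightarrow> complex" where
  "jet_coeff a i j =
     (\<Sum>s \<in> {s :: nat list. length s = i \<and> sum_list s = j \<and> (\<forall>l \<in> set s. 1 \<le> l)}.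
        prod_list (map a s))"

text \<open>Matrices are indexed from 0, whence the shift. Only \<open>a 1, ..., a k\<close> matter.\<close>

definition jet_mat :: "nat \<Rightarrow> (nat \<Rightarrow> complex) \<Rightarrow> complex mat" where
  "jet_mat k a = mat k k (\<lambda>(i, j). jet_coeff a (i + 1) (j + 1))"

definition jet_group :: "nat \<Rightarrow> complex mat monoid" where
  "jet_group k = \<lparr>carrier = {jet_mat k a |a. a 1 \<noteq> 0}, monoid.mult = (*), monoid.one = 1\<^sub>m k\<rparr>"


section \<open>Polynomial functions and the Zariski topology\<close>

inductive_set poly_fun :: "nat \<Rightarrow> (complex mat \<Rightarrow> complex) set" for k :: nat where
  const: "(\<lambda>x. c) \<in> poly_fun k"
| coord: "i < k \<Longrightarrow> j < k \<Longrightarrow> (\<lambda>x. x $$ (i, j)) \<in> poly_fun k"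
| add: "p \<in> poly_fun k \<Longrightarrow> q \<in> poly_fun k \<Longrightarrow> (\<lambda>x. p x + q x) \<in> poly_fun k"
| mult: "p \<in> poly_fun k \<Longrightarrow> q \<in> poly_fun k \<Longrightarrow> (\<lambda>x. p x * q x) \<in> poly_fun k"

definition zariski :: "nat \<Rightarrow> complex mat set \<Rightarrow> complex mat topology" where
  "zariski k V = topology (\<lambda>U. \<exists>P \<subseteq> poly_fun k. U = {x \<in> V. \<exists>p \<in> P. p x \<noteq> 0})"

lemma istopology_zariski:
  "istopology (\<lambda>U. \<exists>P \<subseteq> poly_fun k. U = {x \<in> V. \<exists>p \<in> P. p x \<noteq> 0})"
  unfolding istopology_def
proof (intro conjI allI impI)
  fix S T
  assume S: "\<exists>P \<subseteq> poly_fun k. S = {x \<in> V. \<exists>p \<in> P. p x \<noteq> 0}"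
    and T: "\<exists>P \<subseteq> poly_fun k. T = {x \<in> V. \<exists>p \<in> P. p x \<noteq> 0}"
  from S obtain P where P: "P \<subseteq> poly_fun k" "S = {x \<in> V. \<exists>p \<in> P. p x \<noteq> 0}"
    by (elim exE conjE)
  from T obtain Q where Q: "Q \<subseteq> poly_fun k" "T = {x \<in> V. \<exists>p \<in> Q. p x \<noteq> 0}"
    by (elim exE conjE)
  let ?R = "(\<lambda>(p, q) x. p x * q x) ` (P \<times> Q)"
  have "?R \<subseteq> poly_fun k"
    using P(1) Q(1) by (auto intro!: poly_fun.mult)
  moreover have "S \<inter> T = {x \<in> V. \<exists>r \<in> ?R. r x \<noteq> 0}"
    unfolding P(2) Q(2) by auto
  ultimately show "\<exists>R \<subseteq> poly_fun k. S \<inter> T = {x \<in> V. \<exists>r \<in> R. r x \<noteq> 0}"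
    by (intro exI[of _ ?R] conjI)
next
  fix K :: "complex mat set set"
  assume K: "\<forall>S \<in> K. \<exists>P \<subseteq> poly_fun k. S = {x \<in> V. \<exists>p \<in> P. p x \<noteq> 0}"
  from bchoice[OF K] obtain P
    where P: "\<forall>S \<in> K. P S \<subseteq> poly_fun k \<and> S = {x \<in> V. \<exists>p \<in> P S. p x \<noteq> 0}"
    by (elim exE)
  let ?R = "\<Union>S \<in> K. P S"
  have mem: "x \<in> S \<longleftrightarrow> x \<in> V \<and> (\<exists>p \<in> P S. p x \<noteq> 0)" if "S \<in> K" for x S
  proof -
    have "S = {x \<in> V. \<exists>p \<in> P S. p x \<noteq> 0}"
      using bspec[OF P that] by (rule conjunct2)
    from arg_cong[OF this, of "\<lambda>A. x \<in> A"]
    have "x \<in> S \<longleftrightarrow> x \<in> {x \<in> V. \<exists>p \<in> P S. p x \<noteq> 0}" .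
    then show ?thesis
      by (simp only: mem_Collect_eq)
  qed
  have "\<Union> K = {x \<in> V. \<exists>p \<in> ?R. p x \<noteq> 0}"
  proof (rule Set.set_eqI)
    fix x
    have "x \<in> \<Union> K \<longleftrightarrow> (\<exists>S \<in> K. x \<in> V \<and> (\<exists>p \<in> P S. p x \<noteq> 0))"
      unfolding Union_iff by (rule bex_cong[OF refl]) (rule mem)
    then show "x \<in> \<Union> K \<longleftrightarrow> x \<in> {x \<in> V. \<exists>p \<in> ?R. p x \<noteq> 0}"
      by (simp only: mem_Collect_eq UN_iff) blast
  qed
  moreover have "?R \<subseteq> poly_fun k"
    by (rule UN_least) (drule bspec[OF P], erule conjunct1)
  ultimately show "\<exists>R \<subseteq> poly_fun k. \<Union> K = {x \<in> V. \<exists>p \<in> R. p x \<noteq> 0}"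
    by (intro exI[of _ ?R] conjI)
qed

lemma openin_zariski:
  "openin (zariski k V) U \<longleftrightarrow> (\<exists>P \<subseteq> poly_fun k. U = {x \<in> V. \<exists>p \<in> P. p x \<noteq> 0})"
  unfolding zariski_def topology_inverse'[OF istopology_zariski] ..


section \<open>Lie algebras, adjoint action, generic stabilizers\<close>

text \<open>The Zariski tangent space at the identity: all \<open>x\<close> with \<open>dp(x) = 0\<close> at \<open>1\<close> for every
  polynomial \<open>p\<close> vanishing on \<open>H\<close>. For a closed subgroup \<open>H\<close> of \<open>GL_k\<close> (which is open in the
  space of matrices) this is the Lie algebra of \<open>H\<close>.\<close>

definition lie_algebra :: "nat \<Rightarrow> complex mat set \<Rightarrow> complex mat set" where
  "lie_algebra k H = {x \<in> carrier_mat k k. \<forall>p \<in> poly_fun k. (\<forall>A \<in> H. p A = 0) \<longrightarrow>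
     ((\<lambda>t. p (1\<^sub>m k + t \<cdot>\<^sub>m x)) has_field_derivative 0) (at 0)}"

abbreviation jet_lie :: "nat \<Rightarrow> complex mat set" where
  "jet_lie k \<equiv> lie_algebra k (carrier (jet_group k))"

definition adjoint :: "nat \<Rightarrow> complex mat \<Rightarrow> complex mat \<Rightarrow> complex mat" where
  "adjoint k g x = g * x * inv\<^bsub>jet_group k\<^esub> g"

definition generic_stabilizer :: "nat \<Rightarrow> complex mat set \<Rightarrow> bool" where
  "generic_stabilizer k H \<longleftrightarrow>
     (let G = jet_group k; Z = stabilizer G (adjoint k) in
      \<exists>U. openin (zariski k (jet_lie k)) U \<and> zariski k (jet_lie k) closure_of U = jet_lie k \<and>
          (\<forall>x \<in> U. \<forall>y \<in> U. \<exists>g \<in> carrier G. Z y = g <#\<^bsub>G\<^esub> Z x #>\<^bsub>G\<^esub> inv\<^bsub>G\<^esub> g) \<and>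
          (\<exists>x \<in> U. H = Z x))"

definition weyl_group :: "nat \<Rightarrow> complex mat set \<Rightarrow> complex mat set monoid" where
  "weyl_group k H = (jet_group k)\<lparr>carrier := normalizer (jet_group k) H\<rparr> Mod H"

text \<open>The action of a coset \<open>w\<close> is the common value of the adjoint actions of its elements
  (it is meaningful only if that value does not depend on the representative).\<close>

definition weyl_action :: "nat \<Rightarrow> complex mat set \<Rightarrow> complex mat \<Rightarrow> complex mat" where
  "weyl_action k w x = the_elem ((\<lambda>n. adjoint k n x) ` w)"


section \<open>Regular and rational functions\<close>

definition regular_ring :: "nat \<Rightarrow> complex mat set \<Rightarrow> (complex mat \<Rightarrow> complex) ring" where
  "regular_ring k V =
     \<lparr>carrier = {restrict p V |p. p \<in> poly_fun k},
      monoid.mult = (\<lambda>f g. \<lambda>x \<in> V. f x * g x),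
      monoid.one = (\<lambda>x \<in> V. 1),
      ring.zero = (\<lambda>x \<in> V. 0),
      ring.add = (\<lambda>f g. \<lambda>x \<in> V. f x + g x)\<rparr>"

definition frac_rel :: "('a, 'b) ring_scheme \<Rightarrow> (('a \<times> 'a) \<times> ('a \<times> 'a)) set" where
  "frac_rel R = {((p, q), (r, s)).
     p \<in> carrier R \<and> q \<in> carrier R - {\<zero>\<^bsub>R\<^esub>} \<and> r \<in> carrier R \<and> s \<in> carrier R - {\<zero>\<^bsub>R\<^esub>} \<and>
     p \<otimes>\<^bsub>R\<^esub> s = r \<otimes>\<^bsub>R\<^esub> q}"

text \<open>The field of fractions of a domain; \<open>p / q\<close> is the class of the pair \<open>(p, q)\<close>.\<close>

definition frac_field :: "('a, 'b) ring_scheme \<Rightarrow> ('a \<times> 'a) set ring" where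
  "frac_field R =
     \<lparr>carrier = (carrier R \<times> (carrier R - {\<zero>\<^bsub>R\<^esub>})) // frac_rel R,
      monoid.mult = (\<lambda>c d. \<Union>(p, q) \<in> c. \<Union>(r, s) \<in> d.
        frac_rel R `` {(p \<otimes>\<^bsub>R\<^esub> r, q \<otimes>\<^bsub>R\<^esub> s)}),
      monoid.one = frac_rel R `` {(\<one>\<^bsub>R\<^esub>, \<one>\<^bsub>R\<^esub>)},
      ring.zero = frac_rel R `` {(\<zero>\<^bsub>R\<^esub>, \<one>\<^bsub>R\<^esub>)},
      ring.add = (\<lambda>c d. \<Union>(p, q) \<in> c. \<Union>(r, s) \<in> d.
        frac_rel R `` {(p \<otimes>\<^bsub>R\<^esub> s \<oplus>\<^bsub>R\<^esub> r \<otimes>\<^bsub>R\<^esub> q, q \<otimes>\<^bsub>R\<^esub> s)})\<rparr>"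

definition rational_field ::
    "nat \<Rightarrow> complex mat set \<Rightarrow> ((complex mat \<Rightarrow> complex) \<times> (complex mat \<Rightarrow> complex)) set ring" where
  "rational_field k V = frac_field (regular_ring k V)"

definition pullback ::
    "complex mat set \<Rightarrow> (complex mat \<Rightarrow> complex mat) \<Rightarrow> (complex mat \<Rightarrow> complex) \<Rightarrow>
     complex mat \<Rightarrow> complex" where
  "pullback V \<phi> f = (\<lambda>x \<in> V. f (\<phi> x))"

text \<open>Invariants of a group \<open>G\<close> acting on \<open>V\<close> through \<open>\<phi>\<close>. On rational functions the group acts
  by pulling back numerators and denominators.\<close>

definition regular_invariants ::
    "nat \<Rightarrow> complex mat set \<Rightarrow> 'g monoid \<Rightarrow> ('g \<Rightarrow> complex mat \<Rightarrow> complex mat) \<Rightarrow>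
     (complex mat \<Rightarrow> complex) ring" where
  "regular_invariants k V G \<phi> = (regular_ring k V)
     \<lparr>carrier := {f \<in> carrier (regular_ring k V). \<forall>g \<in> carrier G. pullback V (\<phi> g) f = f}\<rparr>"

definition rational_invariants ::
    "nat \<Rightarrow> complex mat set \<Rightarrow> 'g monoid \<Rightarrow> ('g \<Rightarrow> complex mat \<Rightarrow> complex mat) \<Rightarrow>
     ((complex mat \<Rightarrow> complex) \<times> (complex mat \<Rightarrow> complex)) set ring" where
  "rational_invariants k V G \<phi> = (rational_field k V)
     \<lparr>carrier := {c \<in> carrier (rational_field k V). \<forall>g \<in> carrier G.
        map_prod (pullback V (\<phi> g)) (pullback V (\<phi> g)) ` c = c}\<rparr>"

definition regular_restrict ::
    "complex mat set \<Rightarrow> (complex mat \<Rightarrow> complex) \<Rightarrow> complex mat \<Rightarrow> complex" where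
  "regular_restrict Y f = restrict f Y"

text \<open>A rational function can be restricted to \<open>Y\<close> if some representing fraction has a
  denominator that is not identically zero on \<open>Y\<close>. Otherwise the result here is the empty set,
  which is not an element of the function field of \<open>Y\<close>.\<close>

definition rational_restrict ::
    "nat \<Rightarrow> complex mat set \<Rightarrow> ((complex mat \<Rightarrow> complex) \<times> (complex mat \<Rightarrow> complex)) set \<Rightarrow>
     ((complex mat \<Rightarrow> complex) \<times> (complex mat \<Rightarrow> complex)) set" where
  "rational_restrict k Y c =
     (\<Union>(p, q) \<in> {(p, q) \<in> c. \<exists>x \<in> Y. q x \<noteq> 0}.
        frac_rel (regular_ring k Y) `` {(regular_restrict Y p, regular_restrict Y q)})"

definition finitely_generated_algebra :: "'a set \<Rightarrow> ('a, 'b) ring_scheme \<Rightarrow> bool" where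
  "finitely_generated_algebra K R \<longleftrightarrow>
     (\<exists>F \<subseteq> carrier R. finite F \<and> generate_ring R (K \<union> F) = carrier R)"

definition constants :: "complex mat set \<Rightarrow> (complex mat \<Rightarrow> complex) set" where
  "constants V = {\<lambda>x \<in> V. c |c. True}"

end

theory Submission
  imports
    Defs
    "HOL-Computational_Algebra.Formal_Power_Series"
    "HOL-Computational_Algebra.Polynomial"
begin

text \<open>Jets compose like power series, and the Lie algebra consists of the vector fields
  \<open>b(t) d/dt\<close> with \<open>b(0) = 0\<close>. A vector field with \<open>b'(0) = l \<noteq> 0\<close> can be linearized to
  \<open>l t d/dt\<close>, because the equation \<open>f' b = l f\<close> is solved by \<open>f = t exp (\<integral> (l / b - 1 / t))\<close>.
  Hence \<open>H\<close> is conjugate to the stabilizer of \<open>t d/dt\<close>, the torus of scalings \<open>t \<mapsto> a t\<close>,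
  which is its own normalizer. So \<open>W\<close> is trivial and \<open>\<hh>\<close> is a line. It meets all orbits on the
  dense set \<open>b'(0) \<noteq> 0\<close> in exactly one point, and \<open>b'(0)\<close>, the upper left matrix entry, is an
  invariant coordinate on it. Therefore every invariant is a function of that entry alone.\<close>

text \<open>The jet of \<open>f\<close> sends the field \<open>b\<close> to the field
  \<open>c\<close> with \<open>c oo f = fps_deriv f * b\<close>; for \<open>c = l t\<close> this is
  the linearization equation. It prescribes the logarithmic derivative
  \<open>f' / f = l / b\<close>. Since \<open>b = l t + ...\<close>, the right side has a simple
  pole of residue 1, which accounts for the factor \<open>t\<close> of \<open>f\<close>; the rest is
  a power series and can be integrated. Series stay untruncated throughout, because matrix entries
  see only coefficients up to degree \<open>k\<close>.

  The open set behind \<open>H\<close> is arbitrary, so \<open>H\<close> is known only up to a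
  conjugation, carried along as \<open>g\<^sub>0\<close>. With \<open>e\<close> the conjugate of
  \<open>t d/dt\<close>, sending \<open>x\<close> to \<open>b'(0) e\<close> is an invariant
  polynomial retraction of \<gg> onto \<hh>; composing with it extends functions from \<hh> to
  invariants.

  The obstacle lies in the rational functions: an invariant fraction need not have invariant
  numerator and denominator, and its denominator may vanish on all of \<hh>. Translating both by one
  suitable group element makes the denominator nonzero somewhere on the line; then the fraction can
  be restricted and extended back.\<close>

unbundle fps_syntax
no_notation Matrix.vec_index (infixl "$" 100)

section \<open>Jets as power series\<close>

text \<open>Row \<open>i\<close> (counted from 1) of the matrix of a jet or of a vector field lists the coefficients
  of the image of \<open>t^i\<close>, under \<open>h \<mapsto> h \<circ> f\<close> and \<open>h \<mapsto> h' b\<close> respectively.\<close>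

definition jet :: "nat \<Rightarrow> complex fps \<Rightarrow> complex mat" where
  "jet k f = mat k k (\<lambda>(i, j). (f ^ Suc i) $ Suc j)"

definition vfield :: "nat \<Rightarrow> complex fps \<Rightarrow> complex mat" where
  "vfield k b = mat k k (\<lambda>(i, j). of_nat (Suc i) * (fps_X ^ i * b) $ Suc j)"

lemma jet_carrier [simp]: "jet k f \<in> carrier_mat k k" "dim_row (jet k f) = k" "dim_col (jet k f) = k"
  by (simp_all add: jet_def)

lemma vfield_carrier [simp]:
  "vfield k b \<in> carrier_mat k k" "dim_row (vfield k b) = k" "dim_col (vfield k b) = k"
  by (simp_all add: vfield_def)

lemma fps_power_nth_cong:
  fixes f g :: "'a :: comm_ring_1 fps"
  assumes "\<And>m. m \<le> n \<Longrightarrow> f $ m = g $ m"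
  shows "(f ^ i) $ n = (g ^ i) $ n"
proof -
  have "\<forall>m \<le> n. (f ^ i) $ m = (g ^ i) $ m"
    by (induction i) (auto simp: fps_mult_nth assms intro!: sum.cong)
  then show ?thesis by simp
qed

lemma jet_cong:
  assumes "\<And>n. n \<le> k \<Longrightarrow> f $ n = g $ n"
  shows "jet k f = jet k g"
  unfolding jet_def by (rule cong_mat) (auto intro!: fps_power_nth_cong assms simp del: power_Suc)

lemma vfield_cong:
  assumes "\<And>n. n \<le> k \<Longrightarrow> b $ n = c $ n"
  shows "vfield k b = vfield k c"
  unfolding vfield_def by (rule cong_mat) (auto simp: fps_X_power_mult_nth assms)

text \<open>Matrix indices start at 0 and stop before \<open>k\<close>, whereas degrees start at 1
  and matter only up to \<open>Suc j\<close>. The degree 0 term dies through \<open>u 0 = 0\<close>,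
  the terms beyond \<open>Suc j\<close> through \<open>c\<close>.\<close>

lemma sum_shift_truncate:
  fixes u c :: "nat \<Rightarrow> 'a :: comm_ring_1"
  assumes "j < k" "u 0 = 0" "\<And>m. m > Suc j \<Longrightarrow> c m = 0"
  shows "(\<Sum>l = 0..<k. u (Suc l) * c (Suc l)) = (\<Sum>m = 0..Suc j. u m * c m)"
proof -
  have "(\<Sum>m = 0..Suc j. u m * c m) = (\<Sum>m = 0..<Suc k. u m * c m)"
    by (rule sum.mono_neutral_left) (use assms in auto)
  also have "\<dots> = (\<Sum>l = 0..<k. u (Suc l) * c (Suc l))"
    by (subst sum.atLeast0_lessThan_Suc_shift) (simp add: assms(2))
  finally show ?thesis by simp
qed

text \<open>Substituting \<open>g\<close> into \<open>u\<close> is multiplication of the coefficient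
  row of \<open>u\<close> by the matrix of \<open>g\<close>. As \<open>g\<close> starts in degree 1,
  \<open>g ^ m\<close> has no coefficients below \<open>m\<close>, so cutting the sum at
  \<open>k\<close> loses nothing.\<close>

lemma mult_jet_nth:
  fixes u g :: "complex fps"
  assumes "j < k" "u $ 0 = 0" "g $ 0 = 0"
  shows "(\<Sum>l = 0..<k. u $ Suc l * (g ^ Suc l) $ Suc j) = (u oo g) $ Suc j"
  using sum_shift_truncate[of j k "\<lambda>m. u $ m" "\<lambda>m. (g ^ m) $ Suc j"] assms
    startsby_zero_power_prefix[OF assms(3)]
  by (simp add: fps_compose_nth)

text \<open>Rows stand on the left of the matrix, so the order of the factors is that of
  composition; row \<open>i\<close> is \<open>mult_jet_nth\<close> for
  \<open>u = f ^ Suc i\<close>.\<close>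

lemma jet_mult:
  assumes "f $ 0 = 0" "g $ 0 = 0"
  shows "jet k f * jet k g = jet k (f oo g)"
proof (rule eq_matI)
  fix i j assume "i < dim_row (jet k (f oo g))" "j < dim_col (jet k (f oo g))"
  then have ij: "i < k" "j < k" by auto
  have "(jet k f * jet k g) $$ (i, j) = (\<Sum>l = 0..<k. (f ^ Suc i) $ Suc l * (g ^ Suc l) $ Suc j)"
    using ij by (simp add: scalar_prod_def jet_def del: power_Suc)
  also have "\<dots> = (f ^ Suc i oo g) $ Suc j"
    by (rule mult_jet_nth) (use ij assms in auto)
  also have "\<dots> = jet k (f oo g) $$ (i, j)"
    using ij assms by (simp add: jet_def fps_compose_power del: power_Suc)
  finally show "(jet k f * jet k g) $$ (i, j) = jet k (f oo g) $$ (i, j)" .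
qed auto

lemma jet_X: "jet k fps_X = 1\<^sub>m k"
  by (rule eq_matI) (auto simp: jet_def fps_X_power_nth simp del: power_Suc)

text \<open>The last hypothesis says that \<open>f\<close> carries the field \<open>b\<close> to
  \<open>c\<close>. Row \<open>i\<close> of either side is then \<open>(i + 1) f^i f' b\<close>: on
  the left as the derivative of \<open>f^(i+1)\<close> along \<open>b\<close>, on the right as
  \<open>(i + 1) t^i c\<close> with \<open>f\<close> substituted.\<close>

lemma jet_mult_vfield:
  assumes "f $ 0 = 0" "b $ 0 = 0" "c $ 0 = 0" "c oo f = fps_deriv f * b"
  shows "jet k f * vfield k b = vfield k c * jet k f"
proof (rule eq_matI)
  fix i j assume "i < dim_row (vfield k c * jet k f)" "j < dim_col (vfield k c * jet k f)"
  then have ij: "i < k" "j < k" by auto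
  have "(jet k f * vfield k b) $$ (i, j) =
      (\<Sum>l = 0..<k. ((f ^ Suc i) $ Suc l * of_nat (Suc l)) * (if Suc j < l then 0 else b $ (Suc j - l)))"
    using ij by (simp add: scalar_prod_def jet_def vfield_def fps_X_power_mult_nth mult.assoc
                     del: power_Suc of_nat_Suc)
  also have "\<dots> = (\<Sum>l = 0..<k. fps_deriv (f ^ Suc i) $ l * (if Suc j < l then 0 else b $ (Suc j - l)))"
    by (rule sum.cong) (auto simp: mult.commute simp del: power_Suc of_nat_Suc)
  \<comment> \<open>For \<open>j = k - 1\<close> the new range contains \<open>l = k\<close>,
    outside the matrix; that term carries the factor \<open>b $ 0 = 0\<close>.\<close>
  also have "\<dots> = (\<Sum>l = 0..Suc j. fps_deriv (f ^ Suc i) $ l * b $ (Suc j - l))"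
    using ij assms
    by (intro sum.mono_neutral_cong) (auto simp: not_less less_Suc_eq_le le_Suc_eq simp del: power_Suc)
  also have "\<dots> = (fps_deriv (f ^ Suc i) * b) $ Suc j"
    by (simp add: fps_mult_nth del: power_Suc)
  also have "fps_deriv (f ^ Suc i) * b = fps_const (of_nat (Suc i)) * (f ^ i * (fps_deriv f * b))"
    by (simp add: fps_deriv_power mult_ac del: power_Suc)
  also have "\<dots> = fps_const (of_nat (Suc i)) * ((fps_X ^ i * c) oo f)"
    using assms by (simp add: fps_compose_mult_distrib fps_compose_power[symmetric])
  also have "\<dots> $ Suc j = of_nat (Suc i) * ((fps_X ^ i * c) oo f) $ Suc j"
    by (simp only: fps_mult_left_const_nth)
  also have "((fps_X ^ i * c) oo f) $ Suc j = (\<Sum>l = 0..<k. (fps_X ^ i * c) $ Suc l * (f ^ Suc l) $ Suc j)"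
    by (rule mult_jet_nth[symmetric]) (use ij assms in auto)
  also have "of_nat (Suc i) * \<dots> = (vfield k c * jet k f) $$ (i, j)"
    using ij by (simp add: scalar_prod_def jet_def vfield_def sum_distrib_left mult.assoc
        del: power_Suc of_nat_Suc)
  finally show "(jet k f * vfield k b) $$ (i, j) = (vfield k c * jet k f) $$ (i, j)" .
qed auto

section \<open>Sums over compositions as coefficients of powers\<close>

lemma compositions_Suc:
  "{s :: nat list. length s = Suc i \<and> sum_list s = j \<and> (\<forall>l \<in> set s. 1 \<le> l)} =
   (\<lambda>(l, s). l # s) ` (SIGMA l:{1..j}. {s. length s = i \<and> sum_list s = j - l \<and> (\<forall>l \<in> set s. 1 \<le> l)})"
  (is "?A = ?B")
proof
  show "?A \<subseteq> ?B"
  proof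
    fix s assume "s \<in> ?A"
    then show "s \<in> ?B" by (cases s) (auto simp: image_iff)
  qed
qed auto

lemma finite_compositions:
  "finite {s :: nat list. length s = i \<and> sum_list s = j \<and> (\<forall>l \<in> set s. 1 \<le> l)}"
proof (induction i arbitrary: j)
  case 0
  then show ?case by (rule finite_subset[of _ "{[]}"]) auto
next
  case (Suc i)
  then show ?case unfolding compositions_Suc by (intro finite_imageI finite_SigmaI) auto
qed

text \<open>One Cauchy product with \<open>f\<close> splits off the first part of a composition; the
  index 0, not allowed as a part, contributes nothing since \<open>f $ 0 = 0\<close>.\<close>

lemma jet_coeff_eq_power_nth:
  assumes "f $ 0 = 0"
  shows "jet_coeff (fps_nth f) i j = (f ^ i) $ j"
proof (induction i arbitrary: j)
  case 0
  have "{s :: nat list. s = [] \<and> sum_list s = j \<and> (\<forall>l \<in> set s. 1 \<le> l)} = (if j = 0 then {[]} else {})"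
    by auto
  then show ?case by (simp add: jet_coeff_def)
next
  case (Suc i)
  let ?C = "\<lambda>i j. {s :: nat list. length s = i \<and> sum_list s = j \<and> (\<forall>l \<in> set s. 1 \<le> l)}"
  have "jet_coeff (fps_nth f) (Suc i) j = (\<Sum>(l, s) \<in> (SIGMA l:{1..j}. ?C i (j - l)). f $ l * prod_list (map (fps_nth f) s))"
    unfolding jet_coeff_def compositions_Suc
    by (subst sum.reindex) (auto simp: inj_on_def intro!: sum.cong)
  also have "\<dots> = (\<Sum>l = 1..j. \<Sum>s \<in> ?C i (j - l). f $ l * prod_list (map (fps_nth f) s))"
    by (rule sum.Sigma[symmetric]) (use finite_compositions in auto)
  also have "\<dots> = (\<Sum>l = 1..j. f $ l * (f ^ i) $ (j - l))"
    by (simp add: Suc[symmetric, unfolded jet_coeff_def] sum_distrib_left)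
  also have "\<dots> = (\<Sum>l = 0..j. f $ l * (f ^ i) $ (j - l))"
    by (rule sum.mono_neutral_left) (auto simp: assms not_less_eq_eq)
  finally show ?case by (simp add: fps_mult_nth)
qed

lemma jet_mat_eq_jet: "f $ 0 = 0 \<Longrightarrow> jet_mat k (fps_nth f) = jet k f"
  by (simp add: jet_mat_def jet_def jet_coeff_eq_power_nth del: power_Suc)

lemma jet_coeff_cong:
  assumes "\<And>l. 1 \<le> l \<Longrightarrow> a l = b l"
  shows "jet_coeff a i j = jet_coeff b i j"
  unfolding jet_coeff_def
  by (intro sum.cong refl arg_cong[where f = prod_list] map_cong) (use assms in auto)

lemma carrier_jet_group: "carrier (jet_group k) = {jet k f |f. f $ 0 = 0 \<and> f $ 1 \<noteq> 0}" (is "_ = ?R")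
proof
  show "carrier (jet_group k) \<subseteq> ?R"
  proof
    fix A assume "A \<in> carrier (jet_group k)"
    then obtain a where a: "A = jet_mat k a" "a 1 \<noteq> 0" by (auto simp: jet_group_def)
    \<comment> \<open>Parts of a composition are positive, so the value \<open>a 0\<close> is
      invisible and can be reset to 0, as substitution of series requires.\<close>
    define f where "f = Abs_fps (\<lambda>n. if n = 0 then 0 else a n)"
    have "jet_mat k a = jet_mat k (fps_nth f)"
      unfolding jet_mat_def by (intro cong_mat) (auto intro!: jet_coeff_cong simp: f_def)
    also have "\<dots> = jet k f" by (rule jet_mat_eq_jet) (simp add: f_def)
    finally show "A \<in> ?R" using a by (auto simp: f_def)
  qed
  show "?R \<subseteq> carrier (jet_group k)"
    by (auto simp: jet_group_def jet_mat_eq_jet[symmetric])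
qed

lemma jet_group_simps [simp]:
  "x \<otimes>\<^bsub>jet_group k\<^esub> y = x * y" "\<one>\<^bsub>jet_group k\<^esub> = 1\<^sub>m k"
  by (simp_all add: jet_group_def)

lemma jet_group_carrier_mat: "g \<in> carrier (jet_group k) \<Longrightarrow> g \<in> carrier_mat k k"
  by (auto simp: carrier_jet_group)

lemma fps_inv_0: "fps_inv (f :: complex fps) $ 0 = 0"
  by (simp add: fps_inv_def)

lemma fps_inv_1: "fps_inv (f :: complex fps) $ 1 = 1 / f $ 1"
  by (simp add: fps_inv_def)

lemma fps_compose_nth_1:
  fixes f g :: "complex fps"
  assumes "g $ 0 = 0"
  shows "(f oo g) $ 1 = f $ 1 * g $ 1"
  by (simp add: fps_compose_nth)

lemma group_jet_group: "group (jet_group k)"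
proof (rule groupI)
  show "\<one>\<^bsub>jet_group k\<^esub> \<in> carrier (jet_group k)"
    by (auto simp: carrier_jet_group jet_X[symmetric] intro!: exI[of _ fps_X])
next
  fix x y assume "x \<in> carrier (jet_group k)" "y \<in> carrier (jet_group k)"
  then obtain f g where "x = jet k f" "f $ 0 = 0" "f $ 1 \<noteq> 0" "y = jet k g" "g $ 0 = 0" "g $ 1 \<noteq> 0"
    by (auto simp: carrier_jet_group)
  then show "x \<otimes>\<^bsub>jet_group k\<^esub> y \<in> carrier (jet_group k)"
    unfolding carrier_jet_group using fps_compose_nth_1[of g f]
    by (auto simp: jet_mult intro!: exI[of _ "f oo g"])
next
  fix x y z assume "x \<in> carrier (jet_group k)" "y \<in> carrier (jet_group k)" "z \<in> carrier (jet_group k)"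
  then show "x \<otimes>\<^bsub>jet_group k\<^esub> y \<otimes>\<^bsub>jet_group k\<^esub> z = x \<otimes>\<^bsub>jet_group k\<^esub> (y \<otimes>\<^bsub>jet_group k\<^esub> z)"
    by (auto dest!: jet_group_carrier_mat simp: assoc_mult_mat)
next
  fix x assume "x \<in> carrier (jet_group k)"
  then show "\<one>\<^bsub>jet_group k\<^esub> \<otimes>\<^bsub>jet_group k\<^esub> x = x"
    by (auto dest!: jet_group_carrier_mat)
next
  fix x assume "x \<in> carrier (jet_group k)"
  then obtain f where f: "x = jet k f" "f $ 0 = 0" "f $ 1 \<noteq> 0" by (auto simp: carrier_jet_group)
  have "jet k (fps_inv f) * jet k f = 1\<^sub>m k"
    using f by (simp add: jet_mult fps_inv_0 fps_inv jet_X)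
  then show "\<exists>y \<in> carrier (jet_group k). y \<otimes>\<^bsub>jet_group k\<^esub> x = \<one>\<^bsub>jet_group k\<^esub>"
    using f fps_inv_0[of f] fps_inv_1[of f]
    by (intro bexI[of _ "jet k (fps_inv f)"]) (auto simp: carrier_jet_group)
qed

lemma vfield_0_0: "1 \<le> k \<Longrightarrow> vfield k b $$ (0, 0) = b $ 1"
  by (simp add: vfield_def)

lemma vfield_linear:
  "vfield k (fps_const s * b + fps_const t * c) = s \<cdot>\<^sub>m vfield k b + t \<cdot>\<^sub>m vfield k c"
  by (rule eq_matI, auto simp: vfield_def fps_X_power_mult_nth simp del: of_nat_Suc)
     (simp_all add: algebra_simps)

lemma vfield_smult: "vfield k (fps_const s * b) = s \<cdot>\<^sub>m vfield k b"
  by (rule eq_matI) (auto simp: vfield_def fps_X_power_mult_nth simp del: of_nat_Suc)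

section \<open>The Lie algebra of the jet group\<close>

lemma poly_fun_uminus: "p \<in> poly_fun k \<Longrightarrow> (\<lambda>x. - p x) \<in> poly_fun k"
  using poly_fun.mult[OF poly_fun.const[of "-1"]] by fastforce

lemma poly_fun_diff: "p \<in> poly_fun k \<Longrightarrow> q \<in> poly_fun k \<Longrightarrow> (\<lambda>x. p x - q x) \<in> poly_fun k"
  using poly_fun.add[OF _ poly_fun_uminus] by fastforce

lemma poly_fun_cmult: "p \<in> poly_fun k \<Longrightarrow> (\<lambda>x. c * p x) \<in> poly_fun k"
  by (rule poly_fun.mult[OF poly_fun.const])

lemma poly_fun_sum: "(\<And>a. a \<in> A \<Longrightarrow> f a \<in> poly_fun k) \<Longrightarrow> (\<lambda>x. \<Sum>a\<in>A. f a x) \<in> poly_fun k"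
  by (induction A rule: infinite_finite_induct) (auto intro: poly_fun.const poly_fun.add)

lemma poly_fun_compose:
  assumes "p \<in> poly_fun k"
    and "\<And>i j. i < k \<Longrightarrow> j < k \<Longrightarrow> (\<lambda>x. \<phi> x $$ (i, j)) \<in> poly_fun k"
  shows "(\<lambda>x. p (\<phi> x)) \<in> poly_fun k"
  using assms(1) by induction (auto intro: poly_fun.intros assms(2))

text \<open>A chain rule in which the order of quantifiers is the point: \<open>D\<close> is fixed
  before the curve, so curves with equal value and velocity at 0 give the same derivative. The value
  \<open>p a\<close> is recorded because the product rule needs it.\<close>

lemma poly_fun_curve_derivative:
  assumes "p \<in> poly_fun k"
  shows "\<exists>D. \<forall>c. (\<forall>i < k. \<forall>j < k. c 0 $$ (i, j) = a $$ (i, j) \<and>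
      ((\<lambda>t. c t $$ (i, j)) has_field_derivative x $$ (i, j)) (at 0)) \<longrightarrow>
    p (c 0) = p a \<and> ((\<lambda>t. p (c t)) has_field_derivative D) (at 0)"
  using assms
proof induction
  case (const c)
  then show ?case by (auto intro!: exI[of _ 0] derivative_eq_intros)
next
  case (coord i j)
  then show ?case by blast
next
  case (add p q)
  then obtain D E where "\<forall>c. (\<forall>i < k. \<forall>j < k. c 0 $$ (i, j) = a $$ (i, j) \<and>
      ((\<lambda>t. c t $$ (i, j)) has_field_derivative x $$ (i, j)) (at 0)) \<longrightarrow>
    p (c 0) = p a \<and> ((\<lambda>t. p (c t)) has_field_derivative D) (at 0)"
    "\<forall>c. (\<forall>i < k. \<forall>j < k. c 0 $$ (i, j) = a $$ (i, j) \<and>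
      ((\<lambda>t. c t $$ (i, j)) has_field_derivative x $$ (i, j)) (at 0)) \<longrightarrow>
    q (c 0) = q a \<and> ((\<lambda>t. q (c t)) has_field_derivative E) (at 0)" by blast
  then show ?case by (intro exI[of _ "D + E"]) (auto intro!: DERIV_add)
next
  case (mult p q)
  then obtain D E where "\<forall>c. (\<forall>i < k. \<forall>j < k. c 0 $$ (i, j) = a $$ (i, j) \<and>
      ((\<lambda>t. c t $$ (i, j)) has_field_derivative x $$ (i, j)) (at 0)) \<longrightarrow>
    p (c 0) = p a \<and> ((\<lambda>t. p (c t)) has_field_derivative D) (at 0)"
    "\<forall>c. (\<forall>i < k. \<forall>j < k. c 0 $$ (i, j) = a $$ (i, j) \<and>
      ((\<lambda>t. c t $$ (i, j)) has_field_derivative x $$ (i, j)) (at 0)) \<longrightarrow>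
    q (c 0) = q a \<and> ((\<lambda>t. q (c t)) has_field_derivative E) (at 0)" by blast
  then show ?case
    by (intro exI[of _ "D * q a + E * p a"]) (auto intro!: derivative_eq_intros)
qed

text \<open>The definition tests along the straight line \<open>1 + t x\<close>, which may leave
  \<open>H\<close>. A curve inside \<open>H\<close> with the same velocity gives the same
  derivative, and along it \<open>p\<close> vanishes.\<close>

lemma lie_algebra_curveI:
  assumes x: "x \<in> carrier_mat k k"
    and c: "\<And>i j. i < k \<Longrightarrow> j < k \<Longrightarrow> c 0 $$ (i, j) = 1\<^sub>m k $$ (i, j)"
      "\<And>i j. i < k \<Longrightarrow> j < k \<Longrightarrow> ((\<lambda>t. c t $$ (i, j)) has_field_derivative x $$ (i, j)) (at 0)"
    and ev: "eventually (\<lambda>t. c t \<in> H) (nhds 0)"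
  shows "x \<in> lie_algebra k H"
  unfolding lie_algebra_def
proof (intro CollectI conjI ballI impI x)
  fix p assume p: "p \<in> poly_fun k" and van: "\<forall>A \<in> H. p A = 0"
  from poly_fun_curve_derivative[OF p, of "1\<^sub>m k" x] obtain D where D:
    "\<And>c. (\<And>i j. i < k \<Longrightarrow> j < k \<Longrightarrow> c 0 $$ (i, j) = 1\<^sub>m k $$ (i, j) \<and>
      ((\<lambda>t. c t $$ (i, j)) has_field_derivative x $$ (i, j)) (at 0)) \<Longrightarrow>
    ((\<lambda>t. p (c t)) has_field_derivative D) (at 0)" by blast
  have "((\<lambda>t. p (c t)) has_field_derivative D) (at 0)" using c by (intro D) auto
  moreover have "((\<lambda>t. p (c t)) has_field_derivative 0) (at 0)"
  proof -
    have "eventually (\<lambda>t. p (c t) = 0) (nhds 0)"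
      using ev by eventually_elim (use van in auto)
    from DERIV_cong_ev[OF refl this refl, of 0] show ?thesis by simp
  qed
  ultimately have "D = 0" by (rule DERIV_unique)
  have "((\<lambda>t. p (1\<^sub>m k + t \<cdot>\<^sub>m x)) has_field_derivative D) (at 0)"
    using x by (intro D) (auto intro!: derivative_eq_intros)
  then show "((\<lambda>t. p (1\<^sub>m k + t \<cdot>\<^sub>m x)) has_field_derivative 0) (at 0)"
    using \<open>D = 0\<close> by simp
qed

lemma fps_power_nth_has_derivative:
  fixes f b :: "complex fps"
  shows "((\<lambda>t. ((f + fps_const t * b) ^ i) $ n) has_field_derivative
    (of_nat i * f ^ (i - 1) * b) $ n) (at 0)"
proof (induction i arbitrary: n)
  case 0
  then show ?case by simp
next
  case (Suc i)
  have "((\<lambda>t. \<Sum>l = 0..n. (f $ l + t * b $ l) * ((f + fps_const t * b) ^ i) $ (n - l))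
      has_field_derivative
      (\<Sum>l = 0..n. b $ l * (f ^ i) $ (n - l) + f $ l * (of_nat i * f ^ (i - 1) * b) $ (n - l))) (at 0)"
    by (rule DERIV_sum) (auto intro!: derivative_eq_intros Suc)
  also have "(\<lambda>t. \<Sum>l = 0..n. (f $ l + t * b $ l) * ((f + fps_const t * b) ^ i) $ (n - l)) =
      (\<lambda>t. ((f + fps_const t * b) ^ Suc i) $ n)"
    unfolding power_Suc by (subst fps_mult_nth) simp
  also have "(\<Sum>l = 0..n. b $ l * (f ^ i) $ (n - l) + f $ l * (of_nat i * f ^ (i - 1) * b) $ (n - l)) =
      (b * f ^ i + f * (of_nat i * f ^ (i - 1) * b)) $ n"
    by (simp add: fps_mult_nth sum.distrib)
  also have "b * f ^ i + f * (of_nat i * f ^ (i - 1) * b) = of_nat (Suc i) * f ^ (Suc i - 1) * b"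
    by (cases i) (simp_all add: algebra_simps)
  finally show ?case .
qed

text \<open>Row 0 of a jet is the series itself, with the coefficient of \<open>t^n\<close> in
  column \<open>n - 1\<close>. Taking it for arbitrary matrices turns the shape of a jet matrix into
  polynomial equations.\<close>

definition row_jet :: "nat \<Rightarrow> complex mat \<Rightarrow> complex fps" where
  "row_jet k A = Abs_fps (\<lambda>n. if n = 0 \<or> n > k then 0 else A $$ (0, n - 1))"

lemma jet_row_jet: "jet k (row_jet k (jet k f)) = jet k f" if "f $ 0 = 0"
  by (rule jet_cong) (use that in \<open>auto simp: row_jet_def jet_def\<close>)

lemma row_jet_0 [simp]: "row_jet k A $ 0 = 0"
  by (simp add: row_jet_def)

lemma poly_fun_row_jet_power: "(\<lambda>A. (row_jet k A ^ i) $ n) \<in> poly_fun k"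
proof (induction i arbitrary: n)
  case 0
  then show ?case by (auto intro: poly_fun.const)
next
  case (Suc i)
  have "(\<lambda>A. row_jet k A $ l) \<in> poly_fun k" for l
    by (cases "l = 0 \<or> l > k") (auto simp: row_jet_def intro!: poly_fun.intros)
  then show ?case by (auto simp: fps_mult_nth intro!: poly_fun_sum poly_fun.mult Suc)
qed

lemma jet_curve_derivative:
  assumes "i < k" "j < k"
  shows "((\<lambda>t. jet k (fps_X + fps_const t * b) $$ (i, j)) has_field_derivative
    vfield k b $$ (i, j)) (at 0)"
  using fps_power_nth_has_derivative[of fps_X b "Suc i" "Suc j"] assms
  by (simp add: jet_def vfield_def mult.assoc fps_of_nat[symmetric] del: of_nat_Suc power_Suc)

lemma eventually_affine_nonzero: "eventually (\<lambda>t :: complex. 1 + t * s \<noteq> 0) (nhds 0)"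
proof -
  have "tendsto (\<lambda>t. 1 + t * s) (1 + 0 * s) (nhds 0)"
    by (intro tendsto_intros filterlim_ident)
  then show ?thesis by (rule tendsto_imp_eventually_ne) simp
qed

text \<open>In a jet every row is a power of the first one. Differentiating these equations at the
  identity shows that row \<open>i\<close> of a tangent vector is \<open>(i + 1) t^i b\<close>,
  where \<open>b\<close> is its first row. Conversely \<open>b\<close> is the velocity of the curve
  \<open>fps_X + fps_const t * b\<close>.\<close>

lemma jet_lie_eq:
  assumes k: "1 \<le> k"
  shows "jet_lie k = {vfield k b |b. b $ 0 = 0}"
proof (intro Set.set_eqI iffI)
  fix x assume x: "x \<in> jet_lie k"
  then have xc: "x \<in> carrier_mat k k" by (simp add: lie_algebra_def)
  have "x = vfield k (row_jet k x)"
  proof (rule eq_matI)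
    fix i j assume "i < dim_row (vfield k (row_jet k x))" "j < dim_col (vfield k (row_jet k x))"
    then have ij: "i < k" "j < k" by auto
    let ?p = "\<lambda>A. A $$ (i, j) - (row_jet k A ^ Suc i) $ Suc j"
    have "?p \<in> poly_fun k"
      by (intro poly_fun_diff poly_fun_row_jet_power poly_fun.coord ij)
    moreover have "?p A = 0" if "A \<in> carrier (jet_group k)" for A
    proof -
      from that obtain f where f: "A = jet k f" "f $ 0 = 0" by (auto simp: carrier_jet_group)
      then have "A $$ (i, j) = jet k (row_jet k A) $$ (i, j)" by (simp add: jet_row_jet)
      also have "\<dots> = (row_jet k A ^ Suc i) $ Suc j" using ij by (simp add: jet_def del: power_Suc)
      finally show ?thesis by simp
    qed
    ultimately have "((\<lambda>t. ?p (1\<^sub>m k + t \<cdot>\<^sub>m x)) has_field_derivative 0) (at 0)"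
      using x by (auto simp: lie_algebra_def)
    moreover have "((\<lambda>t. ?p (1\<^sub>m k + t \<cdot>\<^sub>m x)) has_field_derivative
      x $$ (i, j) - (of_nat (Suc i) * fps_X ^ (Suc i - 1) * row_jet k x) $ Suc j) (at 0)"
    proof (rule DERIV_diff)
      show "((\<lambda>t. (1\<^sub>m k + t \<cdot>\<^sub>m x) $$ (i, j)) has_field_derivative x $$ (i, j)) (at 0)"
        using ij xc by (auto intro!: derivative_eq_intros)
      have "row_jet k (1\<^sub>m k + t \<cdot>\<^sub>m x) = fps_X + fps_const t * row_jet k x" for t
        using xc k by (auto simp: fps_eq_iff row_jet_def)
      then show "((\<lambda>t. (row_jet k (1\<^sub>m k + t \<cdot>\<^sub>m x) ^ Suc i) $ Suc j) has_field_derivative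
          (of_nat (Suc i) * fps_X ^ (Suc i - 1) * row_jet k x) $ Suc j) (at 0)"
        by (simp only: fps_power_nth_has_derivative)
    qed
    ultimately have "x $$ (i, j) - (of_nat (Suc i) * fps_X ^ (Suc i - 1) * row_jet k x) $ Suc j = 0"
      by (rule DERIV_unique[symmetric])
    then show "x $$ (i, j) = vfield k (row_jet k x) $$ (i, j)"
      using ij by (simp add: vfield_def mult.assoc fps_of_nat[symmetric] del: of_nat_Suc)
  qed (use xc in auto)
  then show "x \<in> {vfield k b |b. b $ 0 = 0}" by auto
next
  fix x assume "x \<in> {vfield k b |b. b $ 0 = 0}"
  then obtain b where b: "x = vfield k b" "b $ 0 = 0" by auto
  show "x \<in> jet_lie k"
  proof (rule lie_algebra_curveI[where c = "\<lambda>t. jet k (fps_X + fps_const t * b)"])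
    fix i j assume ij: "i < k" "j < k"
    show "jet k (fps_X + fps_const 0 * b) $$ (i, j) = 1\<^sub>m k $$ (i, j)"
      by (simp add: jet_X)
    show "((\<lambda>t. jet k (fps_X + fps_const t * b) $$ (i, j)) has_field_derivative x $$ (i, j)) (at 0)"
      unfolding b by (rule jet_curve_derivative[OF ij])
  next
    \<comment> \<open>The linear coefficient is \<open>1 + t * b $ 1\<close>, which is guaranteed to
      be nonzero only for small \<open>t\<close>.\<close>
    show "eventually (\<lambda>t. jet k (fps_X + fps_const t * b) \<in> carrier (jet_group k)) (nhds 0)"
      using eventually_affine_nonzero[of "b $ 1"] by eventually_elim (use b in \<open>auto simp: carrier_jet_group\<close>)
  qed (simp add: b)
qed

section \<open>Adjoint action and linearization\<close>

lemma mat_jet_inv: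
  assumes "g \<in> carrier (jet_group k)"
  shows "inv\<^bsub>jet_group k\<^esub> g \<in> carrier (jet_group k)" "inv\<^bsub>jet_group k\<^esub> g \<in> carrier_mat k k"
    "inv\<^bsub>jet_group k\<^esub> g * g = 1\<^sub>m k" "g * inv\<^bsub>jet_group k\<^esub> g = 1\<^sub>m k"
  using group.inv_closed[OF group_jet_group assms] group.l_inv[OF group_jet_group assms]
    group.r_inv[OF group_jet_group assms]
  by (auto dest: jet_group_carrier_mat)

lemma adjoint_carrier:
  "g \<in> carrier (jet_group k) \<Longrightarrow> x \<in> carrier_mat k k \<Longrightarrow> adjoint k g x \<in> carrier_mat k k"
  using mat_jet_inv jet_group_carrier_mat unfolding adjoint_def by (meson mult_carrier_mat)

lemma adjoint_eq_iff:
  assumes "g \<in> carrier (jet_group k)" "x \<in> carrier_mat k k" "y \<in> carrier_mat k k"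
  shows "adjoint k g x = y \<longleftrightarrow> g * x = y * g"
proof -
  note c = jet_group_carrier_mat[OF assms(1)] mat_jet_inv[OF assms(1)]
  have "adjoint k g x * g = g * x" "y * g * inv\<^bsub>jet_group k\<^esub> g = y"
    unfolding adjoint_def using c assms(2,3)
    by (simp_all add: assoc_mult_mat[where ?n\<^sub>1 = k and ?n\<^sub>2 = k and ?n\<^sub>3 = k and ?n\<^sub>4 = k])
  then show ?thesis by (metis adjoint_def)
qed

lemma adjoint_mult:
  assumes "g \<in> carrier (jet_group k)" "h \<in> carrier (jet_group k)" "x \<in> carrier_mat k k"
  shows "adjoint k (g * h) x = adjoint k g (adjoint k h x)"
proof -
  note c = jet_group_carrier_mat[OF assms(1)] mat_jet_inv[OF assms(1)]
    jet_group_carrier_mat[OF assms(2)] mat_jet_inv[OF assms(2)]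
  have "inv\<^bsub>jet_group k\<^esub> (g * h) = inv\<^bsub>jet_group k\<^esub> h * inv\<^bsub>jet_group k\<^esub> g"
    using group.inv_mult_group[OF group_jet_group assms(1,2)] by simp
  then show ?thesis
    unfolding adjoint_def using c assms(3)
    by (simp add: assoc_mult_mat[where ?n\<^sub>1 = k and ?n\<^sub>2 = k and ?n\<^sub>3 = k and ?n\<^sub>4 = k])
qed

lemma adjoint_one: "x \<in> carrier_mat k k \<Longrightarrow> adjoint k (1\<^sub>m k) x = x"
  using monoid.inv_one[OF group.is_monoid[OF group_jet_group], of k] by (simp add: adjoint_def)

lemma adjoint_inverse:
  assumes "g \<in> carrier (jet_group k)" "x \<in> carrier_mat k k"
  shows "adjoint k (inv\<^bsub>jet_group k\<^esub> g) (adjoint k g x) = x"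
    "adjoint k g (adjoint k (inv\<^bsub>jet_group k\<^esub> g) x) = x"
  using assms adjoint_mult[OF mat_jet_inv(1) _ assms(2), of g g]
    adjoint_mult[OF _ mat_jet_inv(1) assms(2), of g g]
  by (simp_all add: mat_jet_inv adjoint_one)

lemma adjoint_smult:
  assumes "g \<in> carrier (jet_group k)" "x \<in> carrier_mat k k"
  shows "adjoint k g (s \<cdot>\<^sub>m x) = s \<cdot>\<^sub>m adjoint k g x"
proof -
  note c = jet_group_carrier_mat[OF assms(1)] mat_jet_inv(2)[OF assms(1)] 
  have "g * x \<in> carrier_mat k k" using c assms by simp
  then show ?thesis
    unfolding adjoint_def using mult_smult_distrib[OF c(1) assms(2)]
      mult_smult_assoc_mat[OF _ c(2)] by simp
qed

lemma adjoint_vfield: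
  assumes "f $ 0 = 0" "f $ 1 \<noteq> 0" "b $ 0 = 0" "c $ 0 = 0" "c oo f = fps_deriv f * b"
  shows "adjoint k (jet k f) (vfield k b) = vfield k c"
  by (subst adjoint_eq_iff) (use assms jet_mult_vfield in \<open>auto simp: carrier_jet_group\<close>)

lemma adjoint_jet_lie:
  assumes k: "1 \<le> k" and g: "g \<in> carrier (jet_group k)" and x: "x \<in> jet_lie k"
  shows "adjoint k g x \<in> jet_lie k" "adjoint k g x $$ (0, 0) = x $$ (0, 0)"
proof -
  from g obtain f where f: "g = jet k f" "f $ 0 = 0" "f $ 1 \<noteq> 0" by (auto simp: carrier_jet_group)
  from x obtain b where b: "x = vfield k b" "b $ 0 = 0" by (auto simp: jet_lie_eq[OF k])
  \<comment> \<open>The equation \<open>?c oo f = fps_deriv f * b\<close> solved for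
    \<open>?c\<close> by the compositional inverse of \<open>f\<close>. In the linear coefficient
    the factors \<open>f $ 1\<close> and \<open>1 / f $ 1\<close> cancel, which makes the upper left
    entry invariant.\<close>
  let ?c = "(fps_deriv f * b) oo fps_inv f"
  have "?c oo f = fps_deriv f * b"
    using f by (simp add: fps_compose_assoc[symmetric] fps_inv_0 fps_inv)
  then have eq: "adjoint k g x = vfield k ?c"
    unfolding f b by (intro adjoint_vfield) (use f b in auto)
  then show "adjoint k g x \<in> jet_lie k" using b by (auto simp: jet_lie_eq[OF k])
  have "?c $ 1 = b $ 1"
    using fps_compose_nth_1[OF fps_inv_0, of "fps_deriv f * b" f] f b fps_inv_1[of f]
    by (simp add: fps_mult_nth)
  then show "adjoint k g x $$ (0, 0) = x $$ (0, 0)" unfolding eq using k by (simp add: b vfield_0_0)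
qed

lemma linearize:
  assumes k: "1 \<le> k" and x: "x \<in> jet_lie k" and nz: "x $$ (0, 0) \<noteq> 0"
  shows "\<exists>g \<in> carrier (jet_group k). adjoint k g x = x $$ (0, 0) \<cdot>\<^sub>m vfield k fps_X"
proof -
  from x obtain b where b: "x = vfield k b" "b $ 0 = 0" by (auto simp: jet_lie_eq[OF k])
  define l where "l = x $$ (0, 0)"
  have l: "b $ 1 = l" "l \<noteq> 0" using nz k by (auto simp: l_def b vfield_0_0)
  define c where "c = fps_shift 1 b"
  have bc: "b = fps_X * c" using b by (auto simp: fps_eq_iff c_def)
  have c0: "c $ 0 = l" using l by (simp add: c_def)
  \<comment> \<open>This is \<open>l / b - 1 / t\<close>, written with \<open>b = fps_X * c\<close>.
    It has no pole, since \<open>c $ 0 = l\<close> gives \<open>l / c\<close> the constant term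
    1.\<close>
  define h where "h = fps_shift 1 (fps_const l * inverse c - 1)"
  have h: "fps_X * h = fps_const l * inverse c - 1"
    using c0 l by (auto simp: fps_eq_iff h_def)
  define u where "u = fps_exp 1 oo fps_integral h 0"
  have u0: "u $ 0 = 1" by (simp add: u_def)
  have du: "fps_deriv u = u * h"
    by (simp add: u_def fps_compose_deriv fps_deriv_fps_integral)
  \<comment> \<open>Now \<open>f' / f = 1 / t + h = l / b\<close>.\<close>
  define f where "f = fps_X * u"
  have "fps_deriv f * b = u * (1 + fps_X * h) * b"
    by (simp add: f_def du algebra_simps)
  also have "\<dots> = fps_const l * (inverse c * c) * u * fps_X"
    unfolding h bc by (simp add: algebra_simps)
  also have "inverse c * c = 1" by (rule inverse_mult_eq_1) (use c0 l in auto)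
  finally have "(fps_const l * fps_X) oo f = fps_deriv f * b"
    by (simp add: f_def fps_compose_mult_distrib mult_ac)
  moreover have f0: "f $ 0 = 0" "f $ 1 \<noteq> 0" using u0 by (simp_all add: f_def)
  ultimately have "adjoint k (jet k f) x = vfield k (fps_const l * fps_X)"
    unfolding b using b by (intro adjoint_vfield) auto
  then show ?thesis using f0 unfolding vfield_smult l_def
    by (intro bexI[of _ "jet k f"]) (auto simp: carrier_jet_group)
qed

section \<open>The torus of scalings\<close>

definition torus :: "nat \<Rightarrow> complex mat set" where
  "torus k = {jet k (fps_const a * fps_X) |a. a \<noteq> 0}"

lemma jet_0_nth: "j < k \<Longrightarrow> jet k f $$ (0, j) = f $ Suc j"
  by (simp add: jet_def)

lemma jet_in_torus:
  assumes "f $ 0 = 0" "f $ 1 \<noteq> 0" "\<And>j. 1 \<le> j \<Longrightarrow> j < k \<Longrightarrow> f $ Suc j = 0"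
  shows "jet k f \<in> torus k"
proof -
  have "jet k f = jet k (fps_const (f $ 1) * fps_X)"
  proof (rule jet_cong)
    fix n assume "n \<le> k"
    then show "f $ n = (fps_const (f $ 1) * fps_X) $ n"
      using assms(1) assms(3)[of "n - 1"] by (cases n) auto
  qed
  then show ?thesis using assms by (auto simp: torus_def)
qed

lemma torus_subset: "torus k \<subseteq> carrier (jet_group k)"
  by (auto simp: torus_def carrier_jet_group)

lemma vfield_X: "vfield k fps_X = mat k k (\<lambda>(i, j). if i = j then of_nat (Suc i) else 0)"
  by (rule eq_matI) (auto simp: vfield_def fps_X_power_mult_nth)

text \<open>\<open>vfield k fps_X\<close> is the diagonal matrix with entries
  \<open>1, ..., k\<close>. Commuting with it means \<open>(j + 1) f $ Suc j = f $ Suc j\<close> in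
  row 0, and row 0 determines a jet.\<close>

lemma stabilizer_smult_vfield_X:
  assumes k: "1 \<le> k" and l: "l \<noteq> 0"
  shows "stabilizer (jet_group k) (adjoint k) (l \<cdot>\<^sub>m vfield k fps_X) = torus k"
proof (intro Set.set_eqI iffI)
  fix g assume "g \<in> stabilizer (jet_group k) (adjoint k) (l \<cdot>\<^sub>m vfield k fps_X)"
  then have g: "g \<in> carrier (jet_group k)"
    "adjoint k g (l \<cdot>\<^sub>m vfield k fps_X) = l \<cdot>\<^sub>m vfield k fps_X"
    by (auto simp: stabilizer_def)
  from g obtain f where f: "g = jet k f" "f $ 0 = 0" "f $ 1 \<noteq> 0" by (auto simp: carrier_jet_group)
  have eq: "g * (l \<cdot>\<^sub>m vfield k fps_X) = (l \<cdot>\<^sub>m vfield k fps_X) * g"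
    using g by (subst (asm) adjoint_eq_iff) auto
  show "g \<in> torus k"
    unfolding f
  proof (rule jet_in_torus[OF f(2,3)])
    fix j assume j: "1 \<le> j" "j < k"
    have "(g * (l \<cdot>\<^sub>m vfield k fps_X)) $$ (0, j) = l * (f $ Suc j * of_nat (Suc j))"
      using j k by (simp add: f vfield_X scalar_prod_def jet_0_nth if_distrib mult_ac cong: if_cong)
    moreover have "((l \<cdot>\<^sub>m vfield k fps_X) * g) $$ (0, j) = l * f $ Suc j"
      using j k by (simp add: f vfield_X scalar_prod_def jet_0_nth if_distrib if_distribR cong: if_cong)
    ultimately have "l * (f $ Suc j * of_nat j) = 0" using eq by (simp add: algebra_simps)
    then show "f $ Suc j = 0" using l j by simp
  qed
next
  fix g assume "g \<in> torus k"
  then obtain a where a: "g = jet k (fps_const a * fps_X)" "a \<noteq> 0" by (auto simp: torus_def)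
  have "adjoint k g (vfield k fps_X) = vfield k fps_X"
    unfolding a by (rule adjoint_vfield) (use a in auto)
  moreover have "g \<in> carrier (jet_group k)" using a torus_subset by (auto simp: torus_def)
  ultimately show "g \<in> stabilizer (jet_group k) (adjoint k) (l \<cdot>\<^sub>m vfield k fps_X)"
    by (simp add: stabilizer_def adjoint_smult)
qed

lemma torus_self_normalizing:
  assumes k: "1 \<le> k" and g: "g \<in> carrier (jet_group k)"
    and "\<And>h. h \<in> torus k \<Longrightarrow> \<exists>h' \<in> torus k. g * h = h' * g"
  shows "g \<in> torus k"
proof -
  from g obtain f where f: "g = jet k f" "f $ 0 = 0" "f $ 1 \<noteq> 0" by (auto simp: carrier_jet_group)
  \<comment> \<open>One scaling is enough, provided that no power of its ratio with exponent from 1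
    to \<open>k - 1\<close> equals 1; the ratio 2 serves. In row 0 the column \<open>j = 0\<close>
    gives \<open>c = 2\<close>, and then \<open>2 ^ j \<noteq> 1\<close> kills the higher
    coefficients.\<close>
  have "jet k (fps_const 2 * fps_X) \<in> torus k" by (auto simp: torus_def)
  from assms(3)[OF this] obtain c where
    "jet k f * jet k (fps_const 2 * fps_X) = jet k (fps_const c * fps_X) * jet k f"
    by (auto simp: torus_def f)
  then have eq: "jet k (f oo (fps_const 2 * fps_X)) = jet k (fps_const c * f)"
    using f by (simp add: jet_mult fps_compose_mult_distrib)
  have eq': "2 ^ Suc j * f $ Suc j = c * f $ Suc j" if "j < k" for j
    using arg_cong[OF eq, of "\<lambda>A. A $$ (0, j)"] that
    by (simp add: jet_0_nth fps_compose_linear)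
  have c: "c = 2" using eq'[of 0] k f by simp
  show ?thesis
    unfolding f
  proof (rule jet_in_torus[OF f(2,3)])
    fix j assume j: "1 \<le> j" "j < k"
    have "(2 :: complex) ^ j \<noteq> 1"
    proof
      assume "(2 :: complex) ^ j = 1"
      then have "norm ((2 :: complex) ^ j) = 1" by simp
      then show False using j one_less_power[of "2 :: real" j] by (simp add: norm_power)
    qed
    then show "f $ Suc j = 0" using eq'[OF j(2)] c by auto
  qed
qed

section \<open>The generic stabilizer\<close>

text \<open>\<open>adjoint\<close> conjugates any matrix, so on group elements it is the inner
  automorphism. The lemmas about it thereby also serve for conjugate subgroups.\<close>

lemma conj_coset_eq_adjoint_image:
  "g <#\<^bsub>jet_group k\<^esub> S #>\<^bsub>jet_group k\<^esub> inv\<^bsub>jet_group k\<^esub> g = adjoint k g ` S"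
  by (auto simp: l_coset_def r_coset_def adjoint_def)

lemma adjoint_in_jet_group:
  "g \<in> carrier (jet_group k) \<Longrightarrow> h \<in> carrier (jet_group k) \<Longrightarrow> adjoint k g h \<in> carrier (jet_group k)"
  using monoid.m_closed[OF group.is_monoid[OF group_jet_group], of _ k] mat_jet_inv(1)[of g k]
  by (simp add: adjoint_def)

text \<open>One inclusion for all \<open>g\<close> suffices: the other is the same statement for the
  inverse of \<open>g\<close> at \<open>adjoint k g x\<close>.\<close>

lemma stabilizer_adjoint_subset:
  assumes g: "g \<in> carrier (jet_group k)" and x: "x \<in> carrier_mat k k"
  shows "adjoint k g ` stabilizer (jet_group k) (adjoint k) x
    \<subseteq> stabilizer (jet_group k) (adjoint k) (adjoint k g x)"
proof (rule image_subsetI)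
  fix h assume "h \<in> stabilizer (jet_group k) (adjoint k) x"
  then have h: "h \<in> carrier (jet_group k)" "adjoint k h x = x" by (auto simp: stabilizer_def)
  have gh: "g * h \<in> carrier (jet_group k)"
    using monoid.m_closed[OF group.is_monoid[OF group_jet_group] g h(1)] by simp
  have "adjoint k (adjoint k g h) (adjoint k g x) =
      adjoint k (g * h) (adjoint k (inv\<^bsub>jet_group k\<^esub> g) (adjoint k g x))"
    unfolding adjoint_def[of k g h]
    by (rule adjoint_mult) (use gh g x mat_jet_inv adjoint_carrier in auto)
  also have "\<dots> = adjoint k g x"
    using g h x by (simp add: adjoint_inverse adjoint_mult)
  finally show "adjoint k g h \<in> stabilizer (jet_group k) (adjoint k) (adjoint k g x)"
    using adjoint_in_jet_group[OF g h(1)] by (simp add: stabilizer_def)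
qed

lemma stabilizer_adjoint:
  assumes g: "g \<in> carrier (jet_group k)" and x: "x \<in> carrier_mat k k"
  shows "stabilizer (jet_group k) (adjoint k) (adjoint k g x) =
    adjoint k g ` stabilizer (jet_group k) (adjoint k) x"
proof
  note g' = mat_jet_inv(1)[OF g] and gx = adjoint_carrier[OF g x]
  show "stabilizer (jet_group k) (adjoint k) (adjoint k g x)
      \<subseteq> adjoint k g ` stabilizer (jet_group k) (adjoint k) x"
  proof
    fix h assume h: "h \<in> stabilizer (jet_group k) (adjoint k) (adjoint k g x)"
    then have "adjoint k (inv\<^bsub>jet_group k\<^esub> g) h \<in> stabilizer (jet_group k) (adjoint k) x"
      using stabilizer_adjoint_subset[OF g' gx] g x by (auto simp: adjoint_inverse)
    moreover have "h = adjoint k g (adjoint k (inv\<^bsub>jet_group k\<^esub> g) h)"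
      using h g by (auto simp: adjoint_inverse stabilizer_def jet_group_carrier_mat)
    ultimately show "h \<in> adjoint k g ` stabilizer (jet_group k) (adjoint k) x" by blast
  qed
qed (rule stabilizer_adjoint_subset[OF g x])

lemma smult_mat_cancel:
  fixes x y :: "complex mat"
  assumes "l \<noteq> 0" "l \<cdot>\<^sub>m x = l \<cdot>\<^sub>m y"
  shows "x = y"
proof (rule eq_matI)
  show dims: "dim_row x = dim_row y" "dim_col x = dim_col y"
    using arg_cong[OF assms(2), of dim_row] arg_cong[OF assms(2), of dim_col] by simp_all
  show "x $$ (i, j) = y $$ (i, j)" if "i < dim_row y" "j < dim_col y" for i j
    using arg_cong[OF assms(2), of "\<lambda>A. A $$ (i, j)"] that assms(1) dims by simp
qed

lemma stabilizer_smult: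
  assumes "l \<noteq> 0" and "x \<in> carrier_mat k k"
  shows "stabilizer (jet_group k) (adjoint k) (l \<cdot>\<^sub>m x) = stabilizer (jet_group k) (adjoint k) x"
  using assms smult_mat_cancel[OF assms(1)] by (auto simp: stabilizer_def adjoint_smult)

lemma adjoint_index:
  assumes "g \<in> carrier (jet_group k)" "x \<in> carrier_mat k k" "i < k" "j < k"
  shows "adjoint k g x $$ (i, j) =
    (\<Sum>b = 0..<k. (\<Sum>a = 0..<k. g $$ (i, a) * x $$ (a, b)) * (inv\<^bsub>jet_group k\<^esub> g) $$ (b, j))"
  using assms jet_group_carrier_mat[OF assms(1)] mat_jet_inv(2)[OF assms(1)]
  by (simp add: adjoint_def scalar_prod_def del: assoc_mult_mat)

text \<open>For fixed \<open>g\<close> the entries of \<open>adjoint k g x\<close> are linear in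
  those of \<open>x\<close>. The agreement is limited to \<open>k\<close> by \<open>k\<close>
  matrices because members of \<open>poly_fun k\<close> are functions on matrices of all
  sizes.\<close>

lemma poly_fun_adjoint:
  assumes "p \<in> poly_fun k" and g: "g \<in> carrier (jet_group k)"
  shows "\<exists>q \<in> poly_fun k. \<forall>x \<in> carrier_mat k k. q x = p (adjoint k g x)"
proof -
  define \<phi> where "\<phi> x = mat k k (\<lambda>(i, j). \<Sum>b = 0..<k.
    (\<Sum>a = 0..<k. g $$ (i, a) * x $$ (a, b)) * (inv\<^bsub>jet_group k\<^esub> g) $$ (b, j))" for x
  have "\<phi> x = adjoint k g x" if x: "x \<in> carrier_mat k k" for x
    by (rule eq_matI) (use adjoint_carrier[OF g x] in \<open>auto simp: \<phi>_def adjoint_index[OF g x]\<close>)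
  moreover have "(\<lambda>x. p (\<phi> x)) \<in> poly_fun k"
    by (rule poly_fun_compose[OF assms(1)])
       (auto simp: \<phi>_def intro!: poly_fun_sum poly_fun.mult[OF _ poly_fun.const]
          poly_fun_cmult poly_fun.coord)
  ultimately show ?thesis by (intro bexI[of _ "\<lambda>x. p (\<phi> x)"]) auto
qed

text \<open>Density makes the unknown open set \<open>U\<close> meet the nonempty open set
  \<open>N\<close> of linearizable fields, in some \<open>y\<close>. Scalars do not change
  stabilizers, so that of \<open>y\<close> is conjugate to that of \<open>t d/dt\<close>, and the
  conjugacy within \<open>U\<close> passes this on to \<open>x\<close>.\<close>

lemma generic_stabilizer_eq:
  assumes k: "1 \<le> k" and "generic_stabilizer k H"
  shows "\<exists>g \<in> carrier (jet_group k).
    H = stabilizer (jet_group k) (adjoint k) (adjoint k g (vfield k fps_X))"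
proof -
  let ?G = "jet_group k" and ?E = "vfield k fps_X"
  let ?Z = "stabilizer ?G (adjoint k)"
  interpret group ?G by (rule group_jet_group)
  from assms(2) obtain U x where U: "openin (zariski k (jet_lie k)) U"
    and dense: "zariski k (jet_lie k) closure_of U = jet_lie k"
    and conj: "\<forall>x \<in> U. \<forall>y \<in> U. \<exists>g \<in> carrier ?G. ?Z y = g <#\<^bsub>?G\<^esub> ?Z x #>\<^bsub>?G\<^esub> inv\<^bsub>?G\<^esub> g"
    and x: "x \<in> U" "H = ?Z x"
    by (auto simp: generic_stabilizer_def Let_def)
  have E: "?E \<in> jet_lie k" by (auto simp: jet_lie_eq[OF k])
  define N where "N = {x \<in> jet_lie k. x $$ (0, 0) \<noteq> 0}"
  have "openin (zariski k (jet_lie k)) N"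
    unfolding openin_zariski N_def
    by (intro exI[of _ "{\<lambda>x. x $$ (0, 0)}"]) (use k in \<open>auto intro: poly_fun.coord\<close>)
  moreover have "?E \<in> N" using E k by (simp add: N_def vfield_0_0)
  moreover have "?E \<in> zariski k (jet_lie k) closure_of U" using E dense by simp
  ultimately obtain y where y: "y \<in> U" "y \<in> N"
    unfolding in_closure_of by blast
  then have "y \<in> jet_lie k" "y $$ (0, 0) \<noteq> 0" by (auto simp: N_def)
  with linearize[OF k this] obtain g1 l where g1: "g1 \<in> carrier ?G" "l \<noteq> 0"
    "adjoint k g1 y = l \<cdot>\<^sub>m ?E" by blast
  have yc: "y \<in> carrier_mat k k" using \<open>y \<in> jet_lie k\<close> by (auto simp: lie_algebra_def)
  have y_eq: "y = adjoint k (inv\<^bsub>?G\<^esub> g1) (l \<cdot>\<^sub>m ?E)"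
    using adjoint_inverse(1)[OF g1(1) yc] g1 by simp
  obtain g2 where g2: "g2 \<in> carrier ?G" "?Z x = g2 <#\<^bsub>?G\<^esub> ?Z y #>\<^bsub>?G\<^esub> inv\<^bsub>?G\<^esub> g2"
    using conj x y by blast
  define g where "g = g2 * inv\<^bsub>?G\<^esub> g1"
  have g: "g \<in> carrier ?G" using m_closed[OF g2(1) inv_closed[OF g1(1)]] by (simp add: g_def)
  have "H = ?Z (adjoint k g2 y)"
    unfolding x g2(2) conj_coset_eq_adjoint_image by (rule stabilizer_adjoint[symmetric, OF g2(1) yc])
  also have "adjoint k g2 y = adjoint k g (l \<cdot>\<^sub>m ?E)"
    unfolding g_def y_eq by (rule adjoint_mult[symmetric]) (use g1 g2 in auto)
  also have "\<dots> = l \<cdot>\<^sub>m adjoint k g ?E" by (rule adjoint_smult[OF g]) simp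
  also have "?Z \<dots> = ?Z (adjoint k g ?E)"
    using g1(2) adjoint_carrier[OF g] by (simp add: stabilizer_smult)
  finally show ?thesis using g by blast
qed

section \<open>The line through a conjugate of \<open>t d/dt\<close>, its stabilizer and Weyl
  group\<close>

locale jet_slice =
  fixes k :: nat and g\<^sub>0 :: "complex mat"
  assumes k: "1 \<le> k" and g\<^sub>0: "g\<^sub>0 \<in> carrier (jet_group k)"
begin

text \<open>Conjugation preserves the upper left entry, so \<open>e\<close> has entry 1 there, and a
  point \<open>t \<cdot>\<^sub>m e\<close> of the line is recovered from that entry.\<close>

definition e :: "complex mat" where "e = adjoint k g\<^sub>0 (vfield k fps_X)"

definition H :: "complex mat set" where "H = stabilizer (jet_group k) (adjoint k) e"

lemma e_jet_lie: "e \<in> jet_lie k"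
  unfolding e_def by (rule adjoint_jet_lie[OF k g\<^sub>0]) (auto simp: jet_lie_eq[OF k])

lemma jet_lie_carrier: "x \<in> jet_lie k \<Longrightarrow> x \<in> carrier_mat k k"
  by (simp add: lie_algebra_def)

lemma e_carrier: "e \<in> carrier_mat k k"
  by (rule jet_lie_carrier[OF e_jet_lie])

lemma e_0_0: "e $$ (0, 0) = 1"
proof -
  have "vfield k fps_X \<in> jet_lie k" by (auto simp: jet_lie_eq[OF k])
  then show ?thesis unfolding e_def
    using adjoint_jet_lie(2)[OF k g\<^sub>0] by (simp add: vfield_0_0[OF k])
qed

lemma jet_lie_comb:
  assumes "x \<in> jet_lie k" "y \<in> jet_lie k"
  shows "s \<cdot>\<^sub>m x + t \<cdot>\<^sub>m y \<in> jet_lie k"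
proof -
  from assms obtain b c where "x = vfield k b" "b $ 0 = 0" "y = vfield k c" "c $ 0 = 0"
    by (auto simp: jet_lie_eq[OF k])
  then show ?thesis unfolding jet_lie_eq[OF k]
    by (auto intro!: exI[of _ "fps_const s * b + fps_const t * c"] simp: vfield_linear)
qed

lemma smult_e_jet_lie: "t \<cdot>\<^sub>m e \<in> jet_lie k"
proof -
  have "t \<cdot>\<^sub>m e + 0 \<cdot>\<^sub>m e = t \<cdot>\<^sub>m e" using e_carrier by auto
  then show ?thesis using jet_lie_comb[OF e_jet_lie e_jet_lie, of t 0] by simp
qed

lemma smult_e_0_0: "(t \<cdot>\<^sub>m e) $$ (0, 0) = t"
  using e_0_0 e_carrier k by auto

text \<open>\<open>linearize\<close> transported by \<open>g\<^sub>0\<close>: both \<open>x\<close>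
  and the multiple of \<open>e\<close> can be moved to the same multiple of
  \<open>t d/dt\<close>.\<close>

lemma orbit_slice:
  assumes "x \<in> jet_lie k" "x $$ (0, 0) \<noteq> 0"
  shows "\<exists>g \<in> carrier (jet_group k). adjoint k g (x $$ (0, 0) \<cdot>\<^sub>m e) = x"
proof -
  interpret group "jet_group k" by (rule group_jet_group)
  let ?E = "vfield k fps_X" and ?l = "x $$ (0, 0)"
  obtain g where g: "g \<in> carrier (jet_group k)" "adjoint k g x = ?l \<cdot>\<^sub>m ?E"
    using linearize[OF k assms] by blast
  let ?h = "inv\<^bsub>jet_group k\<^esub> g * inv\<^bsub>jet_group k\<^esub> g\<^sub>0"
  have h: "?h \<in> carrier (jet_group k)"
    using m_closed[OF inv_closed[OF g(1)] inv_closed[OF g\<^sub>0]] by simp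
  have "adjoint k ?h (?l \<cdot>\<^sub>m e) = adjoint k (inv\<^bsub>jet_group k\<^esub> g) (adjoint k (inv\<^bsub>jet_group k\<^esub> g\<^sub>0) (?l \<cdot>\<^sub>m e))"
    by (rule adjoint_mult) (use g g\<^sub>0 e_carrier in auto)
  also have "adjoint k (inv\<^bsub>jet_group k\<^esub> g\<^sub>0) (?l \<cdot>\<^sub>m e) = ?l \<cdot>\<^sub>m ?E"
    unfolding e_def adjoint_smult[OF g\<^sub>0 vfield_carrier(1), symmetric]
    by (rule adjoint_inverse[OF g\<^sub>0]) simp
  also have "adjoint k (inv\<^bsub>jet_group k\<^esub> g) (?l \<cdot>\<^sub>m ?E) = x"
    using adjoint_inverse(1)[OF g(1) jet_lie_carrier[OF assms(1)]] g by simp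
  finally show ?thesis using h by blast
qed

lemma H_eq: "H = adjoint k g\<^sub>0 ` torus k"
  unfolding H_def e_def stabilizer_adjoint[OF g\<^sub>0 vfield_carrier(1)]
  using stabilizer_smult_vfield_X[OF k, of 1] stabilizer_smult[of 1 "vfield k fps_X" k] by simp

text \<open>Conjugated back by \<open>g\<^sub>0\<close>, \<open>H\<close> consists of diagonal
  matrices, so the entries \<open>(0, j)\<close> with \<open>j \<ge> 1\<close> give linear equations
  for \<open>H\<close>. The conjugated tangent vector \<open>y\<close> satisfies them too, which
  leaves a multiple of \<open>t d/dt\<close>.\<close>

lemma lie_algebra_H: "lie_algebra k H = {t \<cdot>\<^sub>m e |t. True}"
proof (intro Set.set_eqI iffI)
  note g' = mat_jet_inv(1)[OF g\<^sub>0]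
  fix x assume x: "x \<in> lie_algebra k H"
  have "H \<subseteq> carrier (jet_group k)" by (auto simp: H_def stabilizer_def)
  with x have xG: "x \<in> jet_lie k" by (auto simp: lie_algebra_def subset_iff)
  then have xc: "x \<in> carrier_mat k k" by (rule jet_lie_carrier)
  define y where "y = adjoint k (inv\<^bsub>jet_group k\<^esub> g\<^sub>0) x"
  have "y \<in> jet_lie k" unfolding y_def by (rule adjoint_jet_lie[OF k g' xG])
  then obtain b where b: "y = vfield k b" "b $ 0 = 0" by (auto simp: jet_lie_eq[OF k])
  have y0: "y $$ (0, j) = 0" if j: "1 \<le> j" "j < k" for j
  proof -
    have "(\<lambda>x. x $$ (0, j)) \<in> poly_fun k" using j by (intro poly_fun.coord) auto
    from poly_fun_adjoint[OF this g'] obtain q where q: "q \<in> poly_fun k"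
      "\<And>x. x \<in> carrier_mat k k \<Longrightarrow> q x = adjoint k (inv\<^bsub>jet_group k\<^esub> g\<^sub>0) x $$ (0, j)" by blast
    have "q A = 0" if "A \<in> H" for A
    proof -
      from that obtain a where a: "A = adjoint k g\<^sub>0 (jet k (fps_const a * fps_X))"
        by (auto simp: H_eq torus_def)
      then have "adjoint k (inv\<^bsub>jet_group k\<^esub> g\<^sub>0) A = jet k (fps_const a * fps_X)"
        using adjoint_inverse[OF g\<^sub>0] by simp
      then show ?thesis using q(2)[of A] j adjoint_carrier[OF g\<^sub>0] by (simp add: a jet_0_nth)
    qed
    with x q(1) have d0: "((\<lambda>t. q (1\<^sub>m k + t \<cdot>\<^sub>m x)) has_field_derivative 0) (at 0)"
      by (auto simp: lie_algebra_def)
    have "q (1\<^sub>m k + t \<cdot>\<^sub>m x) = q (1\<^sub>m k) + t * y $$ (0, j)" for t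
    proof -
      have "q (1\<^sub>m k + t \<cdot>\<^sub>m x) = adjoint k (inv\<^bsub>jet_group k\<^esub> g\<^sub>0) (1\<^sub>m k + t \<cdot>\<^sub>m x) $$ (0, j)"
        "q (1\<^sub>m k) = adjoint k (inv\<^bsub>jet_group k\<^esub> g\<^sub>0) (1\<^sub>m k) $$ (0, j)"
        using xc by (auto intro!: q(2))
      then show ?thesis
        unfolding y_def using adjoint_index[OF g', of _ 0 j] xc j
        by (simp add: ring_distribs sum.distrib sum_distrib_left sum_distrib_right mult_ac)
    qed
    then have "((\<lambda>t. q (1\<^sub>m k + t \<cdot>\<^sub>m x)) has_field_derivative y $$ (0, j)) (at 0)"
      by (auto intro!: derivative_eq_intros)
    from DERIV_unique[OF this d0] show ?thesis .
  qed
  have "b $ n = (fps_const (b $ 1) * fps_X) $ n" if "n \<le> k" for n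
    using y0[of "n - 1"] that b by (cases n) (auto simp: vfield_def)
  then have "y = b $ 1 \<cdot>\<^sub>m vfield k fps_X"
    unfolding b vfield_smult[symmetric] by (rule vfield_cong)
  moreover have "x = adjoint k g\<^sub>0 y" using g\<^sub>0 xc by (simp add: y_def adjoint_inverse)
  ultimately have "x = b $ 1 \<cdot>\<^sub>m e" using g\<^sub>0 by (simp add: e_def adjoint_smult)
  then show "x \<in> {t \<cdot>\<^sub>m e |t. True}" by blast
next
  fix x assume "x \<in> {t \<cdot>\<^sub>m e |t. True}"
  then obtain s where s: "x = s \<cdot>\<^sub>m e" by blast
  let ?c = "\<lambda>t. fps_X + fps_const t * (fps_const s * fps_X) :: complex fps"
  have x: "x = adjoint k g\<^sub>0 (vfield k (fps_const s * fps_X))"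
    using g\<^sub>0 by (simp add: s e_def vfield_smult adjoint_smult)
  have c: "?c t = fps_const (1 + t * s) * fps_X" for t by (auto simp: fps_eq_iff)
  show "x \<in> lie_algebra k H"
  proof (rule lie_algebra_curveI[where c = "\<lambda>t. adjoint k g\<^sub>0 (jet k (?c t))"])
    fix i j assume ij: "i < k" "j < k"
    show "adjoint k g\<^sub>0 (jet k (?c 0)) $$ (i, j) = 1\<^sub>m k $$ (i, j)"
      using mat_jet_inv(4)[OF g\<^sub>0] jet_group_carrier_mat[OF g\<^sub>0] by (simp add: jet_X adjoint_def)
    show "((\<lambda>t. adjoint k g\<^sub>0 (jet k (?c t)) $$ (i, j)) has_field_derivative x $$ (i, j)) (at 0)"
      unfolding x adjoint_index[OF g\<^sub>0 jet_carrier(1) ij] adjoint_index[OF g\<^sub>0 vfield_carrier(1) ij]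
      by (intro DERIV_sum DERIV_cmult_right DERIV_cmult jet_curve_derivative) auto
  next
    show "eventually (\<lambda>t. adjoint k g\<^sub>0 (jet k (?c t)) \<in> H) (nhds 0)"
      using eventually_affine_nonzero[of s] by eventually_elim (auto simp only: H_eq torus_def c)
  qed (simp add: s e_carrier)
qed

text \<open>Conjugating \<open>n\<close> by \<open>g\<^sub>0\<close> gives \<open>m\<close>, which
  normalizes the torus and hence lies in it. So \<open>m\<close> fixes \<open>t d/dt\<close>, that
  is, \<open>n\<close> fixes \<open>e\<close>.\<close>

lemma normalizer_H: "normalizer (jet_group k) H \<subseteq> H"
proof
  interpret group "jet_group k" by (rule group_jet_group)
  let ?E = "vfield k fps_X"
  let ?Z = "stabilizer (jet_group k) (adjoint k)"
  let ?h = "inv\<^bsub>jet_group k\<^esub> g\<^sub>0"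
  have h: "?h \<in> carrier (jet_group k)" by (rule mat_jet_inv[OF g\<^sub>0])
  fix n assume "n \<in> normalizer (jet_group k) H"
  \<comment> \<open>\<open>normalizer\<close> lets the group act on subsets of its carrier only;
    this inclusion allows the definition to be evaluated at \<open>H\<close>.\<close>
  moreover have "H \<subseteq> carrier (jet_group k)" by (auto simp: H_def stabilizer_def)
  ultimately have n: "n \<in> carrier (jet_group k)" "adjoint k n ` H = H"
    unfolding normalizer_def stabilizer_def by (auto simp: conj_coset_eq_adjoint_image)
  define m where "m = ?h * (n * g\<^sub>0)"
  have ng: "n * g\<^sub>0 \<in> carrier (jet_group k)" using m_closed[OF n(1) g\<^sub>0] by simp
  have m: "m \<in> carrier (jet_group k)" using m_closed[OF h ng] by (simp add: m_def)
  have mE: "adjoint k m ?E = adjoint k ?h (adjoint k n e)"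
    unfolding m_def e_def using h ng n(1) g\<^sub>0 adjoint_carrier by (simp add: adjoint_mult)
  have ne: "adjoint k n e \<in> carrier_mat k k" by (rule adjoint_carrier[OF n(1) e_carrier])
  have T: "?Z ?E = torus k"
    using stabilizer_smult_vfield_X[OF k, of 1] stabilizer_smult[of 1 "?E" k] by simp
  have "adjoint k m ` torus k = ?Z (adjoint k m ?E)"
    using stabilizer_adjoint[OF m, of ?E] T by simp
  also have "\<dots> = adjoint k ?h ` (adjoint k n ` H)"
    unfolding mE H_def using stabilizer_adjoint[OF h ne] stabilizer_adjoint[OF n(1) e_carrier] by simp
  also have "\<dots> = ?Z (adjoint k ?h e)"
    unfolding n(2) unfolding H_def using stabilizer_adjoint[OF h e_carrier] by simp
  also have "adjoint k ?h e = ?E"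
    unfolding e_def by (rule adjoint_inverse[OF g\<^sub>0]) simp
  finally have mT: "adjoint k m ` torus k = torus k" using T by simp
  have "m \<in> torus k"
  proof (rule torus_self_normalizing[OF k m])
    fix t assume t: "t \<in> torus k"
    then have "t \<in> carrier_mat k k" using torus_subset jet_group_carrier_mat by blast
    moreover from this have "adjoint k m t \<in> carrier_mat k k" by (rule adjoint_carrier[OF m])
    ultimately have "m * t = adjoint k m t * m" using adjoint_eq_iff[OF m] by blast
    then show "\<exists>h' \<in> torus k. m * t = h' * m" using mT t by blast
  qed
  then have "adjoint k m ?E = ?E" unfolding T[symmetric] by (simp add: stabilizer_def)
  then have "adjoint k g\<^sub>0 (adjoint k ?h (adjoint k n e)) = e" unfolding mE by (simp add: e_def)
  then have "adjoint k n e = e" using adjoint_inverse(2)[OF g\<^sub>0 ne] by simp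
  then show "n \<in> H" using n(1) by (simp add: H_def stabilizer_def)
qed

lemma subgroup_H: "subgroup H (jet_group k)"
proof -
  interpret group "jet_group k" by (rule group_jet_group)
  show ?thesis
  proof (rule subgroupI)
    show "H \<subseteq> carrier (jet_group k)" by (auto simp: H_def stabilizer_def)
    have "\<one>\<^bsub>jet_group k\<^esub> \<in> H"
      using adjoint_one[OF e_carrier] one_closed by (simp add: H_def stabilizer_def)
    then show "H \<noteq> {}" by blast
  next
    fix a assume "a \<in> H"
    then show "inv\<^bsub>jet_group k\<^esub> a \<in> H"
      using adjoint_inverse(1)[OF _ e_carrier, of a] by (auto simp: H_def stabilizer_def)
  next
    fix a b assume "a \<in> H" "b \<in> H"
    then show "a \<otimes>\<^bsub>jet_group k\<^esub> b \<in> H"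
      using adjoint_mult[OF _ _ e_carrier, of a b] m_closed[of a b] by (auto simp: H_def stabilizer_def)
  qed
qed

lemma carrier_weyl_group: "carrier (weyl_group k H) \<subseteq> {H}"
proof
  interpret group "jet_group k" by (rule group_jet_group)
  fix w assume "w \<in> carrier (weyl_group k H)"
  then obtain a where a: "a \<in> normalizer (jet_group k) H" "w = H #>\<^bsub>jet_group k\<^esub> a"
    by (auto simp: weyl_group_def FactGroup_def RCOSETS_def r_coset_def)
  then have "a \<in> H" using normalizer_H by blast
  then have "w = H" using a coset_join2[OF _ subgroup_H, of a] subgroup.subset[OF subgroup_H] by blast
  then show "w \<in> {H}" by simp
qed

lemma adjoint_H_fixes:
  assumes "n \<in> H" "x \<in> lie_algebra k H"
  shows "adjoint k n x = x"
proof -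
  from assms(2) obtain t where "x = t \<cdot>\<^sub>m e" by (auto simp: lie_algebra_H)
  then show ?thesis
    using assms(1) by (auto simp: H_def stabilizer_def adjoint_smult e_carrier)
qed

text \<open>All representatives act in the same way and \<open>H\<close> is nonempty, so the image
  in \<open>weyl_action\<close> is a singleton and \<open>the_elem\<close> is determined.\<close>

lemma weyl_action_eq:
  assumes "w \<in> carrier (weyl_group k H)" "x \<in> lie_algebra k H"
  shows "weyl_action k w x = x"
proof -
  have "w = H" using assms carrier_weyl_group by blast
  moreover have "(\<lambda>n. adjoint k n x) ` H = {x}"
    using adjoint_H_fixes[OF _ assms(2)] subgroup.one_closed[OF subgroup_H] by auto
  ultimately show ?thesis by (simp add: weyl_action_def)
qed

end

section \<open>Fraction fields and regular functions\<close>

lemma frac_field_simps: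
  "carrier (frac_field R) = (carrier R \<times> (carrier R - {\<zero>\<^bsub>R\<^esub>})) // frac_rel R"
  "\<one>\<^bsub>frac_field R\<^esub> = frac_rel R `` {(\<one>\<^bsub>R\<^esub>, \<one>\<^bsub>R\<^esub>)}"
  "c \<otimes>\<^bsub>frac_field R\<^esub> d =
     (\<Union>(p, q) \<in> c. \<Union>(r, s) \<in> d. frac_rel R `` {(p \<otimes>\<^bsub>R\<^esub> r, q \<otimes>\<^bsub>R\<^esub> s)})"
  "c \<oplus>\<^bsub>frac_field R\<^esub> d =
     (\<Union>(p, q) \<in> c. \<Union>(r, s) \<in> d.
        frac_rel R `` {(p \<otimes>\<^bsub>R\<^esub> s \<oplus>\<^bsub>R\<^esub> r \<otimes>\<^bsub>R\<^esub> q, q \<otimes>\<^bsub>R\<^esub> s)})"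
  by (simp_all add: frac_field_def)

context domain
begin

abbreviation "fractions \<equiv> carrier R \<times> (carrier R - {\<zero>})"

lemma frac_rel_iff:
  "((p, q), (r, s)) \<in> frac_rel R \<longleftrightarrow>
    (p, q) \<in> fractions \<and> (r, s) \<in> fractions \<and> p \<otimes> s = r \<otimes> q"
  by (auto simp: frac_rel_def)

lemma equiv_frac_rel: "equiv fractions (frac_rel R)"
proof (rule equivI)
  show "frac_rel R \<subseteq> fractions \<times> fractions" by (auto simp: frac_rel_def)
  show "refl_on fractions (frac_rel R)"
    by (auto simp: refl_on_def frac_rel_def)
  show "sym (frac_rel R)" by (auto simp: sym_def frac_rel_def)
  show "trans (frac_rel R)"
  proof (rule transI, clarsimp simp: frac_rel_def)
    fix p q r s t u
    assume c: "p \<in> carrier R" "q \<in> carrier R" "r \<in> carrier R" "s \<in> carrier R" "s \<noteq> \<zero>"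
      "t \<in> carrier R" "u \<in> carrier R" and eq: "p \<otimes> s = r \<otimes> q" "r \<otimes> u = t \<otimes> s"
    \<comment> \<open>Transitivity rests on cancelling the nonzero middle denominator
      \<open>s\<close>.\<close>
    have "s \<otimes> (p \<otimes> u) = (p \<otimes> s) \<otimes> u" using c by (simp add: m_ac)
    also have "\<dots> = (r \<otimes> u) \<otimes> q" using c by (simp add: eq(1) m_ac)
    also have "\<dots> = s \<otimes> (t \<otimes> q)" using c by (simp add: eq(2) m_ac)
    finally show "p \<otimes> u = t \<otimes> q" using c by (simp add: m_lcancel)
  qed
qed

lemma frac_class_eq_iff:
  assumes "(p, q) \<in> fractions" "(r, s) \<in> fractions"
  shows "frac_rel R `` {(p, q)} = frac_rel R `` {(r, s)} \<longleftrightarrow> p \<otimes> s = r \<otimes> q"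
  using eq_equiv_class_iff[OF equiv_frac_rel assms] assms by (simp add: frac_rel_iff)

lemma mem_frac_class_iff:
  assumes "(p, q) \<in> fractions"
  shows "(r, s) \<in> frac_rel R `` {(p, q)} \<longleftrightarrow> (r, s) \<in> fractions \<and> p \<otimes> s = r \<otimes> q"
  using assms by (simp add: frac_rel_iff)

lemma frac_class_self: "(p, q) \<in> fractions \<Longrightarrow> (p, q) \<in> frac_rel R `` {(p, q)}"
  by (simp add: frac_rel_iff)

lemma fractions_mult:
  "(p, q) \<in> fractions \<Longrightarrow> (r, s) \<in> fractions \<Longrightarrow> (p \<otimes> r, q \<otimes> s) \<in> fractions"
  by (auto simp: integral_iff)

lemma fractions_add:
  "(p, q) \<in> fractions \<Longrightarrow> (r, s) \<in> fractions \<Longrightarrow> (p \<otimes> s \<oplus> r \<otimes> q, q \<otimes> s) \<in> fractions"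
  by (auto simp: integral_iff)

text \<open>The operation is a union over all pairs of representatives. Each pair yields the same
  class, so the union collapses to it.\<close>

lemma frac_class_mult:
  assumes pq: "(p, q) \<in> fractions" and rs: "(r, s) \<in> fractions"
  shows "frac_rel R `` {(p, q)} \<otimes>\<^bsub>frac_field R\<^esub> frac_rel R `` {(r, s)} =
    frac_rel R `` {(p \<otimes> r, q \<otimes> s)}"
  unfolding frac_field_simps
proof (rule UN_constant_eq[OF frac_class_self[OF pq]], clarify)
  have key: "frac_rel R `` {(p' \<otimes> r', q' \<otimes> s')} = frac_rel R `` {(p \<otimes> r, q \<otimes> s)}"
    if "((p, q), (p', q')) \<in> frac_rel R" "((r, s), (r', s')) \<in> frac_rel R" for p' q' r' s'
  proof (subst frac_class_eq_iff)
    from that have eq: "p \<otimes> q' = p' \<otimes> q" "r \<otimes> s' = r' \<otimes> s"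
      and m: "(p', q') \<in> fractions" "(r', s') \<in> fractions"
      using pq rs by (auto simp: frac_rel_iff)
    show "(p' \<otimes> r', q' \<otimes> s') \<in> fractions" by (rule fractions_mult[OF m])
    show "(p \<otimes> r, q \<otimes> s) \<in> fractions" by (rule fractions_mult[OF pq rs])
    have "p' \<otimes> r' \<otimes> (q \<otimes> s) = (p' \<otimes> q) \<otimes> (r' \<otimes> s)" using m pq rs by (auto simp: m_ac)
    also have "\<dots> = (p \<otimes> q') \<otimes> (r \<otimes> s')" by (simp add: eq)
    also have "\<dots> = p \<otimes> r \<otimes> (q' \<otimes> s')" using m pq rs by (auto simp: m_ac)
    finally show "p' \<otimes> r' \<otimes> (q \<otimes> s) = p \<otimes> r \<otimes> (q' \<otimes> s')" .
  qed
  show "(\<Union>(r, s) \<in> frac_rel R `` {(r, s)}. frac_rel R `` {(p' \<otimes> r, q' \<otimes> s)}) =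
      frac_rel R `` {(p \<otimes> r, q \<otimes> s)}" if "((p, q), (p', q')) \<in> frac_rel R" for p' q'
    by (rule UN_constant_eq[OF frac_class_self[OF rs]], clarify) (rule key[OF that])
qed

lemma frac_class_add:
  assumes pq: "(p, q) \<in> fractions" and rs: "(r, s) \<in> fractions"
  shows "frac_rel R `` {(p, q)} \<oplus>\<^bsub>frac_field R\<^esub> frac_rel R `` {(r, s)} =
    frac_rel R `` {(p \<otimes> s \<oplus> r \<otimes> q, q \<otimes> s)}"
  unfolding frac_field_simps
proof (rule UN_constant_eq[OF frac_class_self[OF pq]], clarify)
  have key: "frac_rel R `` {(p' \<otimes> s' \<oplus> r' \<otimes> q', q' \<otimes> s')} =
      frac_rel R `` {(p \<otimes> s \<oplus> r \<otimes> q, q \<otimes> s)}"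
    if "((p, q), (p', q')) \<in> frac_rel R" "((r, s), (r', s')) \<in> frac_rel R" for p' q' r' s'
  proof (subst frac_class_eq_iff)
    from that have eq: "p \<otimes> q' = p' \<otimes> q" "r \<otimes> s' = r' \<otimes> s"
      and m: "(p', q') \<in> fractions" "(r', s') \<in> fractions"
      using pq rs by (auto simp: frac_rel_iff)
    show "(p' \<otimes> s' \<oplus> r' \<otimes> q', q' \<otimes> s') \<in> fractions" by (rule fractions_add[OF m])
    show "(p \<otimes> s \<oplus> r \<otimes> q, q \<otimes> s) \<in> fractions" by (rule fractions_add[OF pq rs])
    have "(p' \<otimes> s' \<oplus> r' \<otimes> q') \<otimes> (q \<otimes> s) =
        (p' \<otimes> q) \<otimes> (s \<otimes> s') \<oplus> (r' \<otimes> s) \<otimes> (q \<otimes> q')"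
      using m pq rs by (auto simp: m_ac l_distr r_distr)
    also have "\<dots> = (p \<otimes> q') \<otimes> (s \<otimes> s') \<oplus> (r \<otimes> s') \<otimes> (q \<otimes> q')" by (simp add: eq)
    also have "\<dots> = (p \<otimes> s \<oplus> r \<otimes> q) \<otimes> (q' \<otimes> s')" using m pq rs by (auto simp: m_ac l_distr r_distr)
    finally show "(p' \<otimes> s' \<oplus> r' \<otimes> q') \<otimes> (q \<otimes> s) = (p \<otimes> s \<oplus> r \<otimes> q) \<otimes> (q' \<otimes> s')" .
  qed
  show "(\<Union>(r, s) \<in> frac_rel R `` {(r, s)}. frac_rel R `` {(p' \<otimes> s \<oplus> r \<otimes> q', q' \<otimes> s)}) =
      frac_rel R `` {(p \<otimes> s \<oplus> r \<otimes> q, q \<otimes> s)}" if "((p, q), (p', q')) \<in> frac_rel R" for p' q'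
    by (rule UN_constant_eq[OF frac_class_self[OF rs]], clarify) (rule key[OF that])
qed

lemma frac_field_cases:
  assumes "c \<in> carrier (frac_field R)"
  obtains p q where "(p, q) \<in> fractions" "c = frac_rel R `` {(p, q)}"
  using assms unfolding frac_field_simps by (auto elim!: quotientE)

lemma frac_class_in_carrier:
  "(p, q) \<in> fractions \<Longrightarrow> frac_rel R `` {(p, q)} \<in> carrier (frac_field R)"
  unfolding frac_field_simps by (rule quotientI)

lemma frac_class_subset:
  assumes "c \<in> carrier (frac_field R)"
  shows "c \<subseteq> fractions"
  using assms unfolding frac_field_simps by (auto elim!: quotientE simp: frac_rel_def)

end

section \<open>Rings of polynomial functions on a set of matrices\<close>

lemma regular_ring_simps [simp]:
  "f \<otimes>\<^bsub>regular_ring k V\<^esub> g = (\<lambda>x \<in> V. f x * g x)"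
  "f \<oplus>\<^bsub>regular_ring k V\<^esub> g = (\<lambda>x \<in> V. f x + g x)"
  "\<one>\<^bsub>regular_ring k V\<^esub> = (\<lambda>x \<in> V. 1)"
  "\<zero>\<^bsub>regular_ring k V\<^esub> = (\<lambda>x \<in> V. 0)"
  by (simp_all add: regular_ring_def)

lemma carrier_regular_ring: "carrier (regular_ring k V) = {restrict p V |p. p \<in> poly_fun k}"
  by (simp add: regular_ring_def)

lemma carrier_regular_ringE:
  assumes "f \<in> carrier (regular_ring k V)"
  obtains p where "p \<in> poly_fun k" "f = restrict p V"
  using assms by (auto simp: carrier_regular_ring)

text \<open>The carrier \<open>C\<close> is left open so that the lemma covers all regular functions
  as well as the invariant ones. Extensionality makes functions that agree on \<open>V\<close>
  equal.\<close>

lemma cring_function_subalgebra: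
  assumes ext: "\<And>f. f \<in> C \<Longrightarrow> f \<in> extensional V"
    and const: "\<And>c. (\<lambda>x \<in> V. c) \<in> C"
    and add: "\<And>f g. f \<in> C \<Longrightarrow> g \<in> C \<Longrightarrow> (\<lambda>x \<in> V. f x + g x) \<in> C"
    and mult: "\<And>f g. f \<in> C \<Longrightarrow> g \<in> C \<Longrightarrow> (\<lambda>x \<in> V. f x * g x) \<in> C"
  shows "cring ((regular_ring k V)\<lparr>carrier := C\<rparr>)"
proof (rule cringI)
  let ?R = "(regular_ring k V)\<lparr>carrier := C\<rparr>"
  have eqI: "f = g" if "f \<in> extensional V" "g \<in> extensional V" "\<And>x. x \<in> V \<Longrightarrow> f x = g x" for f g :: "complex mat \<Rightarrow> complex"
    using that by (rule extensionalityI)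
  show "abelian_group ?R"
  proof (rule abelian_groupI)
    fix f assume f: "f \<in> carrier ?R"
    have "(\<lambda>x \<in> V. (\<lambda>x \<in> V. - 1) x * f x) \<in> C" using f by (intro mult const) auto
    then show "\<exists>g \<in> carrier ?R. g \<oplus>\<^bsub>?R\<^esub> f = \<zero>\<^bsub>?R\<^esub>"
      by (intro bexI[of _ "\<lambda>x \<in> V. (\<lambda>x \<in> V. - 1) x * f x"]) (auto simp: fun_eq_iff regular_ring_def)
  qed (auto simp: regular_ring_def ext algebra_simps intro!: add const eqI)
  show "comm_monoid ?R"
    by (rule comm_monoidI) (auto simp: regular_ring_def ext mult_ac intro!: mult const eqI)
qed (auto simp: regular_ring_def algebra_simps intro!: extensionalityI[of _ V])

lemma cring_regular_ring: "cring (regular_ring k V)"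
proof -
  have "cring ((regular_ring k V)\<lparr>carrier := carrier (regular_ring k V)\<rparr>)"
  proof (rule cring_function_subalgebra)
    fix f g assume "f \<in> carrier (regular_ring k V)" "g \<in> carrier (regular_ring k V)"
    then obtain p q where pq: "p \<in> poly_fun k" "q \<in> poly_fun k" "f = restrict p V" "g = restrict q V"
      by (elim carrier_regular_ringE)
    have "(\<lambda>x \<in> V. f x + g x) = restrict (\<lambda>x. p x + q x) V"
      "(\<lambda>x \<in> V. f x * g x) = restrict (\<lambda>x. p x * q x) V" by (auto simp: pq)
    then show "(\<lambda>x \<in> V. f x + g x) \<in> carrier (regular_ring k V)"
      "(\<lambda>x \<in> V. f x * g x) \<in> carrier (regular_ring k V)"
      unfolding carrier_regular_ring using pq(1,2) by (auto intro: poly_fun.intros)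
  qed (auto simp: carrier_regular_ring intro: poly_fun.const)
  then show ?thesis by simp
qed

lemma poly_fun_line:
  assumes "p \<in> poly_fun k" "x \<in> carrier_mat k k" "y \<in> carrier_mat k k"
  shows "\<exists>r. \<forall>t. p ((1 - t) \<cdot>\<^sub>m x + t \<cdot>\<^sub>m y) = poly r t"
  using assms(1)
proof induction
  case (const c)
  then show ?case by (intro exI[of _ "pCons c 0"]) simp
next
  case (coord i j)
  then show ?case using assms(2,3)
    by (intro exI[of _ "pCons (x $$ (i, j)) (pCons (y $$ (i, j) - x $$ (i, j)) 0)"]) (auto simp: algebra_simps)
next
  case (add p q)
  then obtain r s where "\<forall>t. p ((1 - t) \<cdot>\<^sub>m x + t \<cdot>\<^sub>m y) = poly r t"
    "\<forall>t. q ((1 - t) \<cdot>\<^sub>m x + t \<cdot>\<^sub>m y) = poly s t" by blast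
  then show ?case by (intro exI[of _ "r + s"]) simp
next
  case (mult p q)
  then obtain r s where "\<forall>t. p ((1 - t) \<cdot>\<^sub>m x + t \<cdot>\<^sub>m y) = poly r t"
    "\<forall>t. q ((1 - t) \<cdot>\<^sub>m x + t \<cdot>\<^sub>m y) = poly s t" by blast
  then show ?case by (intro exI[of _ "r * s"]) simp
qed

text \<open>Irreducibility of an affine subspace: on the line through \<open>x\<close> and
  \<open>y\<close> both functions become nonzero polynomials in one variable, whose product has only
  finitely many roots in an infinite field.\<close>

lemma poly_fun_mult_nonzero:
  assumes V: "V \<subseteq> carrier_mat k k"
    and line: "\<And>x y t. x \<in> V \<Longrightarrow> y \<in> V \<Longrightarrow> (1 - t) \<cdot>\<^sub>m x + t \<cdot>\<^sub>m y \<in> V"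
    and p: "p \<in> poly_fun k" "x \<in> V" "p x \<noteq> 0"
    and q: "q \<in> poly_fun k" "y \<in> V" "q y \<noteq> 0"
  shows "\<exists>z \<in> V. p z \<noteq> 0 \<and> q z \<noteq> 0"
proof -
  have c: "x \<in> carrier_mat k k" "y \<in> carrier_mat k k" using V p q by auto
  obtain r where r: "\<And>t. p ((1 - t) \<cdot>\<^sub>m x + t \<cdot>\<^sub>m y) = poly r t" using poly_fun_line[OF p(1) c] by blast
  obtain s where s: "\<And>t. q ((1 - t) \<cdot>\<^sub>m x + t \<cdot>\<^sub>m y) = poly s t" using poly_fun_line[OF q(1) c] by blast
  have "(1 - 0) \<cdot>\<^sub>m x + 0 \<cdot>\<^sub>m y = x" "(1 - 1) \<cdot>\<^sub>m x + 1 \<cdot>\<^sub>m y = y" using c by auto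
  then have "poly r 0 \<noteq> 0" "poly s 1 \<noteq> 0" using r[of 0] s[of 1] p q by auto
  then have "r * s \<noteq> 0" by auto
  then have "finite {t. poly (r * s) t = 0}" by (rule poly_roots_finite)
  then obtain t where "poly (r * s) t \<noteq> 0"
    using infinite_UNIV_char_0[where 'a = complex] by (metis (mono_tags) UNIV_eq_I mem_Collect_eq)
  then show ?thesis using r[of t] s[of t] line[OF p(2) q(2), of t]
    by (intro bexI[of _ "(1 - t) \<cdot>\<^sub>m x + t \<cdot>\<^sub>m y"]) auto
qed

lemma domain_regular_ring:
  assumes V: "V \<subseteq> carrier_mat k k" "V \<noteq> {}"
    and line: "\<And>x y t. x \<in> V \<Longrightarrow> y \<in> V \<Longrightarrow> (1 - t) \<cdot>\<^sub>m x + t \<cdot>\<^sub>m y \<in> V"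
  shows "domain (regular_ring k V)"
proof (rule domain.intro[OF cring_regular_ring], rule domain_axioms.intro)
  show "\<one>\<^bsub>regular_ring k V\<^esub> \<noteq> \<zero>\<^bsub>regular_ring k V\<^esub>"
    using V(2) by (auto simp: fun_eq_iff)
next
  fix f g assume "f \<otimes>\<^bsub>regular_ring k V\<^esub> g = \<zero>\<^bsub>regular_ring k V\<^esub>"
  then have prod: "f x * g x = 0" if "x \<in> V" for x
    using that by (auto simp: fun_eq_iff split: if_splits)
  assume "f \<in> carrier (regular_ring k V)" "g \<in> carrier (regular_ring k V)"
  then obtain p q where pq: "p \<in> poly_fun k" "q \<in> poly_fun k" "f = restrict p V" "g = restrict q V"
    by (elim carrier_regular_ringE)
  show "f = \<zero>\<^bsub>regular_ring k V\<^esub> \<or> g = \<zero>\<^bsub>regular_ring k V\<^esub>"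
  proof (rule ccontr)
    assume "\<not> ?thesis"
    then obtain x y where "x \<in> V" "p x \<noteq> 0" "y \<in> V" "q y \<noteq> 0"
      by (auto simp: pq fun_eq_iff split: if_splits)
    from poly_fun_mult_nonzero[OF V(1) line pq(1) this(1,2) pq(2) this(3,4)]
    show False using prod pq by force
  qed
qed

section \<open>Restriction to the line\<close>

context jet_slice
begin

abbreviation "\<gg> \<equiv> jet_lie k"
abbreviation "\<hh> \<equiv> lie_algebra k H"
abbreviation "G \<equiv> jet_group k"
abbreviation "W \<equiv> weyl_group k H"

text \<open>Composition with the linear retraction of \<gg> onto \<hh> given by the upper left
  entry. As that entry is invariant, this extends \<open>p\<close> from \<hh> to an invariant
  function on \<gg>.\<close>

definition slice_fun :: "(complex mat \<Rightarrow> complex) \<Rightarrow> complex mat \<Rightarrow> complex" where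
  "slice_fun p x = p (x $$ (0, 0) \<cdot>\<^sub>m e)"

lemma \<hh>_subset: "\<hh> \<subseteq> \<gg>"
  using smult_e_jet_lie by (auto simp: lie_algebra_H)

lemma smult_e_\<hh>: "t \<cdot>\<^sub>m e \<in> \<hh>"
  by (auto simp: lie_algebra_H)

lemma \<hh>_eq: "x \<in> \<hh> \<Longrightarrow> x $$ (0, 0) \<cdot>\<^sub>m e = x"
  by (auto simp: lie_algebra_H smult_e_0_0)

lemma slice_fun_\<hh>: "x \<in> \<hh> \<Longrightarrow> slice_fun p x = p x"
  by (simp add: slice_fun_def \<hh>_eq)

lemma slice_fun_slice: "slice_fun p (x $$ (0, 0) \<cdot>\<^sub>m e) = slice_fun p x"
  by (simp add: slice_fun_def smult_e_0_0)

lemma slice_fun_adjoint: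
  "a \<in> carrier G \<Longrightarrow> x \<in> \<gg> \<Longrightarrow> slice_fun p (adjoint k a x) = slice_fun p x"
  by (simp add: slice_fun_def adjoint_jet_lie(2)[OF k])

lemma slice_fun_poly:
  assumes "p \<in> poly_fun k"
  shows "slice_fun p \<in> poly_fun k"
  unfolding slice_fun_def
proof (rule poly_fun_compose[OF assms])
  fix i j assume ij: "i < k" "j < k"
  have "(\<lambda>x. x $$ (0, 0) * e $$ (i, j)) \<in> poly_fun k"
    using k by (intro poly_fun.mult poly_fun.coord poly_fun.const) auto
  then show "(\<lambda>x. (x $$ (0, 0) \<cdot>\<^sub>m e) $$ (i, j)) \<in> poly_fun k"
    using ij e_carrier by simp
qed

lemma \<gg>_carrier: "\<gg> \<subseteq> carrier_mat k k"
  using jet_lie_carrier by blast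

lemma \<gg>_line: "x \<in> \<gg> \<Longrightarrow> y \<in> \<gg> \<Longrightarrow> (1 - t) \<cdot>\<^sub>m x + t \<cdot>\<^sub>m y \<in> \<gg>"
  by (rule jet_lie_comb)

lemma \<hh>_line:
  assumes "x \<in> \<hh>" "y \<in> \<hh>"
  shows "(1 - t) \<cdot>\<^sub>m x + t \<cdot>\<^sub>m y \<in> \<hh>"
proof -
  from assms obtain r s where rs: "x = r \<cdot>\<^sub>m e" "y = s \<cdot>\<^sub>m e" by (auto simp: lie_algebra_H)
  have "(1 - t) \<cdot>\<^sub>m x + t \<cdot>\<^sub>m y = ((1 - t) * r + t * s) \<cdot>\<^sub>m e"
    by (rule eq_matI) (use e_carrier in \<open>auto simp: rs algebra_simps\<close>)
  then show ?thesis by (simp add: smult_e_\<hh>)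
qed

sublocale R: domain "regular_ring k \<gg>"
  by (rule domain_regular_ring[OF \<gg>_carrier _ \<gg>_line]) (use e_jet_lie in auto)

sublocale S: domain "regular_ring k \<hh>"
  by (rule domain_regular_ring[OF _ _ \<hh>_line])
     (use \<hh>_subset \<gg>_carrier smult_e_\<hh> in \<open>auto simp: subset_iff\<close>)

text \<open>If \<open>p\<close> and \<open>q\<close> differed at \<open>x\<close>, irreducibility
  would give a point where \<open>p - q\<close> and the upper left entry are both nonzero;
  \<open>e\<close> shows that this entry is not identically zero.\<close>

lemma eq_on_dense:
  assumes "p \<in> poly_fun k" "q \<in> poly_fun k"
    and "\<And>x. x \<in> \<gg> \<Longrightarrow> x $$ (0, 0) \<noteq> 0 \<Longrightarrow> p x = q x" and "x \<in> \<gg>"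
  shows "p x = q x"
proof (rule ccontr)
  assume "p x \<noteq> q x"
  then have ne: "p x - q x \<noteq> 0" by simp
  have "(\<lambda>x. x $$ (0, 0)) \<in> poly_fun k" using k by (intro poly_fun.coord) auto
  from poly_fun_mult_nonzero[OF \<gg>_carrier \<gg>_line poly_fun_diff[OF assms(1,2)] assms(4) ne this e_jet_lie]
  obtain z where "z \<in> \<gg>" "p z - q z \<noteq> 0" "z $$ (0, 0) \<noteq> 0" using e_0_0 by auto
  then show False using assms(3) by simp
qed

lemma regular_ring_restrict: "p \<in> poly_fun k \<Longrightarrow> restrict p V \<in> carrier (regular_ring k V)"
  by (auto simp: carrier_regular_ring)

lemma pullback_regular:
  assumes "a \<in> carrier G" "f \<in> carrier (regular_ring k \<gg>)"
  shows "pullback \<gg> (adjoint k a) f \<in> carrier (regular_ring k \<gg>)"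
proof -
  from assms(2) obtain p where p: "p \<in> poly_fun k" "f = restrict p \<gg>" by (rule carrier_regular_ringE)
  from poly_fun_adjoint[OF p(1) assms(1)] obtain q where q: "q \<in> poly_fun k"
    "\<And>x. x \<in> carrier_mat k k \<Longrightarrow> q x = p (adjoint k a x)" by blast
  have "pullback \<gg> (adjoint k a) f = restrict q \<gg>"
    using jet_lie_carrier adjoint_jet_lie(1)[OF k assms(1)]
    by (auto simp: pullback_def p(2) q(2) fun_eq_iff)
  then show ?thesis using q(1) by (simp add: regular_ring_restrict)
qed

section \<open>Regular invariants\<close>

lemma regular_invariantsD:
  assumes "f \<in> carrier (regular_invariants k \<gg> G (adjoint k))"
  shows "f \<in> carrier (regular_ring k \<gg>)"
    "\<And>a x. a \<in> carrier G \<Longrightarrow> x \<in> \<gg> \<Longrightarrow> f (adjoint k a x) = f x"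
proof -
  show "f \<in> carrier (regular_ring k \<gg>)" using assms by (simp add: regular_invariants_def)
  fix a x assume a: "a \<in> carrier G" and x: "x \<in> \<gg>"
  then have "pullback \<gg> (adjoint k a) f = f" using assms by (simp add: regular_invariants_def)
  from fun_cong[OF this, of x] x show "f (adjoint k a x) = f x" by (simp add: pullback_def)
qed

lemma regular_invariantsI:
  assumes "f \<in> carrier (regular_ring k \<gg>)"
    and "\<And>a x. a \<in> carrier G \<Longrightarrow> x \<in> \<gg> \<Longrightarrow> f (adjoint k a x) = f x"
  shows "f \<in> carrier (regular_invariants k \<gg> G (adjoint k))"
  using assms by (auto simp: regular_invariants_def pullback_def fun_eq_iff elim!: carrier_regular_ringE)

lemma slice_fun_invariant:
  assumes "p \<in> poly_fun k"
  shows "restrict (slice_fun p) \<gg> \<in> carrier (regular_invariants k \<gg> G (adjoint k))"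
  by (rule regular_invariantsI)
     (auto simp: assms regular_ring_restrict slice_fun_poly slice_fun_adjoint adjoint_jet_lie(1)[OF k])

text \<open>On the dense part each \<open>x\<close> lies in the orbit of its retraction to the line,
  so \<open>f\<close> has the same value at both. Hence a polynomial representing \<open>f\<close>
  agrees on \<gg> with its own slice function.\<close>

lemma regular_invariant_eq_slice_fun:
  assumes "f \<in> carrier (regular_invariants k \<gg> G (adjoint k))"
  shows "\<exists>p \<in> poly_fun k. f = restrict (slice_fun p) \<gg>"
proof -
  note f = regular_invariantsD[OF assms]
  from f(1) obtain p where p: "p \<in> poly_fun k" "f = restrict p \<gg>" by (rule carrier_regular_ringE)
  have "p x = slice_fun p x" if "x \<in> \<gg>" for x
  proof (rule eq_on_dense[OF p(1) slice_fun_poly[OF p(1)] _ that])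
    fix x assume x: "x \<in> \<gg>" "x $$ (0, 0) \<noteq> 0"
    from orbit_slice[OF this] obtain a where a: "a \<in> carrier G"
      "adjoint k a (x $$ (0, 0) \<cdot>\<^sub>m e) = x" by blast
    have "f x = f (x $$ (0, 0) \<cdot>\<^sub>m e)"
      using f(2)[OF a(1) smult_e_jet_lie, of "x $$ (0, 0)"] a(2) by simp
    then show "p x = slice_fun p x" using x(1) by (simp add: p(2) slice_fun_def smult_e_jet_lie)
  qed
  then show ?thesis using p by (auto intro!: bexI[of _ p])
qed

lemma weyl_invariants_regular:
  "regular_invariants k \<hh> W (weyl_action k) = regular_ring k \<hh>"
proof -
  have "pullback \<hh> (weyl_action k w) f = f"
    if "w \<in> carrier W" "f \<in> carrier (regular_ring k \<hh>)" for w f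
    using that weyl_action_eq by (auto simp: pullback_def fun_eq_iff elim!: carrier_regular_ringE)
  then have "{f \<in> carrier (regular_ring k \<hh>). \<forall>w \<in> carrier W. pullback \<hh> (weyl_action k w) f = f}
      = carrier (regular_ring k \<hh>)" by auto
  then show ?thesis by (simp add: regular_invariants_def)
qed

text \<open>The inverse extends \<open>p\<close> from the line by \<open>slice_fun p\<close>.
  Invariance is no condition on the target, as the Weyl group acts trivially.\<close>

lemma regular_restrict_iso:
  "regular_restrict \<hh> \<in> ring_iso (regular_invariants k \<gg> G (adjoint k))
     (regular_invariants k \<hh> W (weyl_action k))"
  unfolding weyl_invariants_regular ring_iso_def
proof (intro CollectI conjI ring_hom_memI)
  let ?A = "regular_invariants k \<gg> G (adjoint k)"
  show maps: "regular_restrict \<hh> f \<in> carrier (regular_ring k \<hh>)" if "f \<in> carrier ?A" for f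
  proof -
    from regular_invariant_eq_slice_fun[OF that] obtain p where
      p: "p \<in> poly_fun k" "f = restrict (slice_fun p) \<gg>" by blast
    have "regular_restrict \<hh> f = restrict (slice_fun p) \<hh>"
      using \<hh>_subset by (auto simp: regular_restrict_def p(2) fun_eq_iff)
    then show ?thesis using p(1) by (simp add: regular_ring_restrict slice_fun_poly)
  qed
  show "regular_restrict \<hh> (f \<otimes>\<^bsub>?A\<^esub> g) =
      regular_restrict \<hh> f \<otimes>\<^bsub>regular_ring k \<hh>\<^esub> regular_restrict \<hh> g" for f g
    using \<hh>_subset by (auto simp: regular_restrict_def regular_invariants_def fun_eq_iff)
  show "regular_restrict \<hh> (f \<oplus>\<^bsub>?A\<^esub> g) =
      regular_restrict \<hh> f \<oplus>\<^bsub>regular_ring k \<hh>\<^esub> regular_restrict \<hh> g" for f g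
    using \<hh>_subset by (auto simp: regular_restrict_def regular_invariants_def fun_eq_iff)
  show "regular_restrict \<hh> \<one>\<^bsub>?A\<^esub> = \<one>\<^bsub>regular_ring k \<hh>\<^esub>"
    using \<hh>_subset by (auto simp: regular_restrict_def regular_invariants_def fun_eq_iff)
  show "bij_betw (regular_restrict \<hh>) (carrier ?A) (carrier (regular_ring k \<hh>))"
    unfolding bij_betw_def
  proof (intro conjI inj_onI equalityI subsetI)
    fix f g assume f: "f \<in> carrier ?A" and g: "g \<in> carrier ?A"
      and eq: "regular_restrict \<hh> f = regular_restrict \<hh> g"
    from regular_invariant_eq_slice_fun[OF f] regular_invariant_eq_slice_fun[OF g] obtain p q where
      pq: "f = restrict (slice_fun p) \<gg>" "g = restrict (slice_fun q) \<gg>" by blast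
    have "f x = g x" if "x \<in> \<gg>" for x
      using fun_cong[OF eq, of "x $$ (0, 0) \<cdot>\<^sub>m e"] that smult_e_\<hh> smult_e_jet_lie
      by (simp add: regular_restrict_def pq slice_fun_slice)
    then show "f = g" unfolding pq by (auto simp: fun_eq_iff)
  next
    fix f assume "f \<in> carrier (regular_ring k \<hh>)"
    then obtain p where p: "p \<in> poly_fun k" "f = restrict p \<hh>" by (rule carrier_regular_ringE)
    have "f = regular_restrict \<hh> (restrict (slice_fun p) \<gg>)"
      using \<hh>_subset by (auto simp: regular_restrict_def p(2) fun_eq_iff slice_fun_\<hh>)
    then show "f \<in> regular_restrict \<hh> ` carrier ?A" using slice_fun_invariant[OF p(1)] by blast
  qed (use maps in auto)
qed

text \<open>After retraction to the line every coordinate is a constant multiple of the upper left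
  entry, so this single function generates the ring over the constants.\<close>

lemma finitely_generated_invariants:
  "finitely_generated_algebra (constants \<gg>) (regular_invariants k \<gg> G (adjoint k))"
proof -
  let ?A = "regular_invariants k \<gg> G (adjoint k)"
  define x\<^sub>0 where "x\<^sub>0 = restrict (\<lambda>x :: complex mat. x $$ (0, 0)) \<gg>"
  have x0: "x\<^sub>0 \<in> carrier ?A"
    unfolding x\<^sub>0_def using k
    by (intro regular_invariantsI regular_ring_restrict poly_fun.coord)
       (auto simp: adjoint_jet_lie[OF k])
  have const: "constants \<gg> \<subseteq> carrier ?A"
    by (auto simp: constants_def intro!: regular_invariantsI regular_ring_restrict poly_fun.const
        adjoint_jet_lie(1)[OF k])
  have A_eq: "?A = (regular_ring k \<gg>)\<lparr>carrier := carrier ?A\<rparr>" by (simp add: regular_invariants_def)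
  have "cring ((regular_ring k \<gg>)\<lparr>carrier := carrier ?A\<rparr>)"
  proof (rule cring_function_subalgebra)
    show "(\<lambda>x \<in> \<gg>. c) \<in> carrier ?A" for c using const by (auto simp: constants_def)
    show "f \<in> extensional \<gg>" if "f \<in> carrier ?A" for f
      using regular_invariantsD(1)[OF that] by (auto elim: carrier_regular_ringE)
    fix f g assume f: "f \<in> carrier ?A" and g: "g \<in> carrier ?A"
    note fg = regular_invariantsD[OF f] regular_invariantsD[OF g]
    show "(\<lambda>x \<in> \<gg>. f x + g x) \<in> carrier ?A" "(\<lambda>x \<in> \<gg>. f x * g x) \<in> carrier ?A"
      using R.a_closed[OF fg(1,3)] R.m_closed[OF fg(1,3)]
      by (auto intro!: regular_invariantsI simp: fg(2,4) adjoint_jet_lie(1)[OF k])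
  qed
  then interpret A: cring ?A by (simp only: A_eq[symmetric])
  let ?K = "constants \<gg> \<union> {x\<^sub>0}"
  \<comment> \<open>The induction runs over \<open>p\<close>, not over the invariant: the
    constituents of \<open>p\<close> need not be invariant, but their slice functions are.\<close>
  have gen: "restrict (slice_fun p) \<gg> \<in> generate_ring ?A ?K" if "p \<in> poly_fun k" for p
    using that
  proof induction
    case (const c)
    have "restrict (slice_fun (\<lambda>x. c)) \<gg> \<in> constants \<gg>"
      by (auto simp: constants_def slice_fun_def fun_eq_iff intro!: exI[of _ c])
    then show ?case by (intro generate_ring.incl UnI1)
  next
    case (coord i j)
    have eq: "restrict (slice_fun (\<lambda>x. x $$ (i, j))) \<gg> = x\<^sub>0 \<otimes>\<^bsub>?A\<^esub> (\<lambda>x \<in> \<gg>. e $$ (i, j))"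
      using coord e_carrier by (auto simp: slice_fun_def x\<^sub>0_def regular_invariants_def fun_eq_iff)
    have "(\<lambda>x \<in> \<gg>. e $$ (i, j)) \<in> constants \<gg>" by (auto simp: constants_def)
    then show ?case unfolding eq by (intro generate_ring.eng_mult generate_ring.incl) (simp, rule UnI1)
  next
    case (add p q)
    have "restrict (slice_fun (\<lambda>x. p x + q x)) \<gg> =
        restrict (slice_fun p) \<gg> \<oplus>\<^bsub>?A\<^esub> restrict (slice_fun q) \<gg>"
      by (auto simp: slice_fun_def regular_invariants_def fun_eq_iff)
    then show ?case using add by (simp only: generate_ring.eng_add)
  next
    case (mult p q)
    have "restrict (slice_fun (\<lambda>x. p x * q x)) \<gg> =
        restrict (slice_fun p) \<gg> \<otimes>\<^bsub>?A\<^esub> restrict (slice_fun q) \<gg>"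
      by (auto simp: slice_fun_def regular_invariants_def fun_eq_iff)
    then show ?case using mult by (simp only: generate_ring.eng_mult)
  qed
  have "generate_ring ?A ?K = carrier ?A"
  proof
    show "generate_ring ?A ?K \<subseteq> carrier ?A"
      by (rule A.generate_ring_incl) (use const x0 in auto)
    show "carrier ?A \<subseteq> generate_ring ?A ?K"
      using gen regular_invariant_eq_slice_fun by blast
  qed
  then show ?thesis
    unfolding finitely_generated_algebra_def using x0 by (intro exI[of _ "{x\<^sub>0}"]) auto
qed

section \<open>Rational invariants\<close>

abbreviation slice_class ::
  "(complex mat \<Rightarrow> complex) \<Rightarrow> (complex mat \<Rightarrow> complex) \<Rightarrow>
   ((complex mat \<Rightarrow> complex) \<times> (complex mat \<Rightarrow> complex)) set" where
  "slice_class p q \<equiv> frac_rel (regular_ring k \<gg>) ``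
     {(restrict (slice_fun p) \<gg>, restrict (slice_fun q) \<gg>)}"

lemma restrict_nonzero: "restrict q V \<noteq> \<zero>\<^bsub>regular_ring k V\<^esub> \<longleftrightarrow> (\<exists>x \<in> V. q x \<noteq> 0)"
  by (auto simp: fun_eq_iff)

lemma slice_fractions:
  assumes "p \<in> poly_fun k" "q \<in> poly_fun k" "\<exists>x \<in> \<hh>. q x \<noteq> 0"
  shows "(restrict (slice_fun p) \<gg>, restrict (slice_fun q) \<gg>) \<in> R.fractions"
    "(restrict p \<hh>, restrict q \<hh>) \<in> S.fractions"
proof -
  have "\<exists>x \<in> \<gg>. slice_fun q x \<noteq> 0"
    using assms(3) \<hh>_subset slice_fun_\<hh>[of _ q] by (metis subsetD)
  then show "(restrict (slice_fun p) \<gg>, restrict (slice_fun q) \<gg>) \<in> R.fractions"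
    using assms(1,2) by (simp add: regular_ring_restrict slice_fun_poly restrict_nonzero del: regular_ring_simps)
  show "(restrict p \<hh>, restrict q \<hh>) \<in> S.fractions"
    using assms by (simp add: regular_ring_restrict restrict_nonzero del: regular_ring_simps)
qed

lemma regular_restrict_regular:
  "f \<in> carrier (regular_ring k \<gg>) \<Longrightarrow> regular_restrict \<hh> f \<in> carrier (regular_ring k \<hh>)"
  using \<hh>_subset by (auto simp: regular_restrict_def carrier_regular_ring Int_absorb2 Int_absorb1)

text \<open>The restriction is a union over all representatives with a usable denominator. The
  cross-multiplied equality of two of them restricts to \<hh>, so all give the same class.\<close>

lemma rational_restrict_class:
  assumes pq: "(p, q) \<in> R.fractions" and nz: "\<exists>x \<in> \<hh>. q x \<noteq> 0"
  shows "rational_restrict k \<hh> (frac_rel (regular_ring k \<gg>) `` {(p, q)}) =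
    frac_rel (regular_ring k \<hh>) `` {(regular_restrict \<hh> p, regular_restrict \<hh> q)}"
proof -
  have *: "(regular_restrict \<hh> r, regular_restrict \<hh> s) \<in> S.fractions"
    if "(r, s) \<in> R.fractions" "\<exists>x \<in> \<hh>. s x \<noteq> 0" for r s
    using that regular_restrict_regular[of r] regular_restrict_regular[of s]
    by (simp add: regular_restrict_def restrict_nonzero del: regular_ring_simps)
  have key: "frac_rel (regular_ring k \<hh>) `` {(regular_restrict \<hh> r, regular_restrict \<hh> s)} =
      frac_rel (regular_ring k \<hh>) `` {(regular_restrict \<hh> p, regular_restrict \<hh> q)}"
    if "((p, q), (r, s)) \<in> frac_rel (regular_ring k \<gg>)" and nz': "\<exists>x \<in> \<hh>. s x \<noteq> 0" for r s
  proof (subst S.frac_class_eq_iff)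
    from that have rs: "(r, s) \<in> R.fractions"
      and eq: "p \<otimes>\<^bsub>regular_ring k \<gg>\<^esub> s = r \<otimes>\<^bsub>regular_ring k \<gg>\<^esub> q"
      unfolding R.frac_rel_iff by blast+
    show "(regular_restrict \<hh> r, regular_restrict \<hh> s) \<in> S.fractions" by (rule *[OF rs nz'])
    show "(regular_restrict \<hh> p, regular_restrict \<hh> q) \<in> S.fractions" by (rule *[OF pq nz])
    have "p x * s x = r x * q x" if "x \<in> \<gg>" for x
      using fun_cong[OF eq, of x] that by simp
    then show "regular_restrict \<hh> r \<otimes>\<^bsub>regular_ring k \<hh>\<^esub> regular_restrict \<hh> q =
        regular_restrict \<hh> p \<otimes>\<^bsub>regular_ring k \<hh>\<^esub> regular_restrict \<hh> s"
      using \<hh>_subset by (auto simp: regular_restrict_def fun_eq_iff subset_iff)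
  qed
  have mem: "(p, q) \<in> {(p', q') \<in> frac_rel (regular_ring k \<gg>) `` {(p, q)}. \<exists>x \<in> \<hh>. q' x \<noteq> 0}"
    using R.frac_class_self[OF pq] nz by blast
  show ?thesis
    unfolding rational_restrict_def by (rule UN_constant_eq[OF mem], clarify) (rule key, auto)
qed

lemma rational_restrict_slice_class:
  assumes "p \<in> poly_fun k" "q \<in> poly_fun k" "\<exists>x \<in> \<hh>. q x \<noteq> 0"
  shows "rational_restrict k \<hh> (slice_class p q) =
    frac_rel (regular_ring k \<hh>) `` {(restrict p \<hh>, restrict q \<hh>)}"
proof -
  have "regular_restrict \<hh> (restrict (slice_fun r) \<gg>) = restrict r \<hh>" for r
    using \<hh>_subset by (auto simp: regular_restrict_def fun_eq_iff slice_fun_\<hh>)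
  moreover have "\<exists>x \<in> \<hh>. restrict (slice_fun q) \<gg> x \<noteq> 0"
    using assms(3) \<hh>_subset slice_fun_\<hh>[of _ q] by force
  ultimately show ?thesis
    using rational_restrict_class[OF slice_fractions(1)[OF assms]] by simp
qed

text \<open>The values of slice functions are values at points of the line, so the cross-multiplied
  equations on \<gg> and on \<hh> are equivalent. This yields injectivity of the
  restriction.\<close>

lemma slice_class_eq_iff:
  assumes "p \<in> poly_fun k" "q \<in> poly_fun k" "\<exists>x \<in> \<hh>. q x \<noteq> 0"
    and "r \<in> poly_fun k" "s \<in> poly_fun k" "\<exists>x \<in> \<hh>. s x \<noteq> 0"
  shows "slice_class p q = slice_class r s \<longleftrightarrow>
    frac_rel (regular_ring k \<hh>) `` {(restrict p \<hh>, restrict q \<hh>)} =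
    frac_rel (regular_ring k \<hh>) `` {(restrict r \<hh>, restrict s \<hh>)}"
proof -
  have "(\<forall>x \<in> \<gg>. slice_fun p x * slice_fun s x = slice_fun r x * slice_fun q x) \<longleftrightarrow>
      (\<forall>x \<in> \<hh>. p x * s x = r x * q x)"
  proof (intro iffI ballI)
    fix x assume "\<forall>x \<in> \<gg>. slice_fun p x * slice_fun s x = slice_fun r x * slice_fun q x" and x: "x \<in> \<hh>"
    then have "slice_fun p x * slice_fun s x = slice_fun r x * slice_fun q x" using \<hh>_subset by blast
    then show "p x * s x = r x * q x" by (simp add: slice_fun_\<hh>[OF x])
  next
    fix x assume "\<forall>x \<in> \<hh>. p x * s x = r x * q x"
    then show "slice_fun p x * slice_fun s x = slice_fun r x * slice_fun q x"
      unfolding slice_fun_def using smult_e_\<hh> by blast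
  qed
  then show ?thesis
    by (subst R.frac_class_eq_iff[OF slice_fractions(1)[OF assms(1-3)] slice_fractions(1)[OF assms(4-6)]],
        subst S.frac_class_eq_iff[OF slice_fractions(2)[OF assms(1-3)] slice_fractions(2)[OF assms(4-6)]])
       (auto simp: fun_eq_iff)
qed

lemma carrier_rational_invariants:
  "c \<in> carrier (rational_invariants k V A \<phi>) \<longleftrightarrow> c \<in> carrier (frac_field (regular_ring k V)) \<and>
     (\<forall>a \<in> carrier A. map_prod (pullback V (\<phi> a)) (pullback V (\<phi> a)) ` c = c)"
  by (simp add: rational_invariants_def rational_field_def)

text \<open>Invariance of a class is an equality of sets of pairs: besides stability under pullback,
  each pair must itself be a pullback. The inverse group element provides the preimage.\<close>

lemma slice_class_invariant:
  assumes p: "p \<in> poly_fun k" and q: "q \<in> poly_fun k" "\<exists>x \<in> \<hh>. q x \<noteq> 0"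
  shows "slice_class p q \<in> carrier (rational_invariants k \<gg> G (adjoint k))"
  unfolding carrier_rational_invariants
proof (intro conjI ballI)
  note fr = slice_fractions(1)[OF p q]
  show "slice_class p q \<in> carrier (frac_field (regular_ring k \<gg>))"
    by (rule R.frac_class_in_carrier[OF fr])
  let ?m = "\<lambda>a. map_prod (pullback \<gg> (adjoint k a)) (pullback \<gg> (adjoint k a))"
  have sub: "?m a z \<in> slice_class p q" if a: "a \<in> carrier G" and z: "z \<in> slice_class p q" for a z
  proof -
    obtain r s where rs: "z = (r, s)" by (cases z)
    with z have mem: "r \<in> carrier (regular_ring k \<gg>)" "s \<in> carrier (regular_ring k \<gg>)"
      "s \<noteq> \<zero>\<^bsub>regular_ring k \<gg>\<^esub>"
      and eq: "restrict (slice_fun p) \<gg> \<otimes>\<^bsub>regular_ring k \<gg>\<^esub> s =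
        r \<otimes>\<^bsub>regular_ring k \<gg>\<^esub> restrict (slice_fun q) \<gg>"
      unfolding rs using R.mem_frac_class_iff[OF fr, of r s] by blast+
    have eq': "slice_fun p x * s x = r x * slice_fun q x" if "x \<in> \<gg>" for x
      using fun_cong[OF eq, of x] that by simp
    have "s \<in> extensional \<gg>" using mem(2) by (auto elim: carrier_regular_ringE)
    then obtain x where x: "x \<in> \<gg>" "s x \<noteq> 0"
      using mem(3) by (auto simp: fun_eq_iff extensional_def split: if_splits)
    note a' = mat_jet_inv(1)[OF a]
    \<comment> \<open>The pulled back denominator is not zero: it is evaluated at the point that
      \<open>a\<close> moves to \<open>x\<close>.\<close>
    have "pullback \<gg> (adjoint k a) s (adjoint k (inv\<^bsub>G\<^esub> a) x) \<noteq> 0"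
      using x adjoint_jet_lie(1)[OF k a' x(1)] adjoint_inverse(2)[OF a jet_lie_carrier[OF x(1)]]
      by (simp add: pullback_def)
    then have "pullback \<gg> (adjoint k a) s \<noteq> \<zero>\<^bsub>regular_ring k \<gg>\<^esub>"
      using adjoint_jet_lie(1)[OF k a' x(1)] by (auto simp: fun_eq_iff)
    moreover have "restrict (slice_fun p) \<gg> \<otimes>\<^bsub>regular_ring k \<gg>\<^esub> pullback \<gg> (adjoint k a) s =
        pullback \<gg> (adjoint k a) r \<otimes>\<^bsub>regular_ring k \<gg>\<^esub> restrict (slice_fun q) \<gg>"
    proof -
      have "slice_fun p x * s (adjoint k a x) = r (adjoint k a x) * slice_fun q x" if "x \<in> \<gg>" for x
        using eq'[OF adjoint_jet_lie(1)[OF k a that]] that by (simp add: slice_fun_adjoint[OF a])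
      then show ?thesis by (auto simp: pullback_def fun_eq_iff)
    qed
    ultimately have "(pullback \<gg> (adjoint k a) r, pullback \<gg> (adjoint k a) s) \<in> slice_class p q"
      unfolding R.mem_frac_class_iff[OF fr] using pullback_regular[OF a] mem(1,2) by blast
    then show ?thesis by (simp add: rs)
  qed
  fix a assume a: "a \<in> carrier G"
  note a' = mat_jet_inv(1)[OF a]
  show "?m a ` slice_class p q = slice_class p q"
  proof (intro equalityI subsetI)
    fix z assume z: "z \<in> slice_class p q"
    obtain r s where rs: "z = (r, s)" by (cases z)
    with z have "r \<in> carrier (regular_ring k \<gg>)" "s \<in> carrier (regular_ring k \<gg>)"
      unfolding rs using R.mem_frac_class_iff[OF fr, of r s] by blast+
    then have ext: "r \<in> extensional \<gg>" "s \<in> extensional \<gg>" by (auto elim: carrier_regular_ringE)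
    have "pullback \<gg> (adjoint k a) (pullback \<gg> (adjoint k (inv\<^bsub>G\<^esub> a)) f) = f"
      if "f \<in> extensional \<gg>" for f
      using that adjoint_jet_lie(1)[OF k a] adjoint_inverse(1)[OF a jet_lie_carrier]
      by (auto simp: pullback_def fun_eq_iff extensional_def)
    then have "z = ?m a (?m (inv\<^bsub>G\<^esub> a) z)" using ext by (simp add: rs)
    then show "z \<in> ?m a ` slice_class p q" using sub[OF a' z] by blast
  next
    fix z assume "z \<in> ?m a ` slice_class p q"
    then obtain y where "z = ?m a y" "y \<in> slice_class p q" by (rule imageE)
    then show "z \<in> slice_class p q" using sub[OF a] by simp
  qed
qed

lemma rational_invariant_eq_slice_class:
  assumes "c \<in> carrier (rational_invariants k \<gg> G (adjoint k))"
  shows "\<exists>p \<in> poly_fun k. \<exists>q \<in> poly_fun k. (\<exists>x \<in> \<hh>. q x \<noteq> 0) \<and> c = slice_class p q"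
proof -
  have c: "c \<in> carrier (frac_field (regular_ring k \<gg>))"
    and inv: "\<And>a. a \<in> carrier G \<Longrightarrow>
      map_prod (pullback \<gg> (adjoint k a)) (pullback \<gg> (adjoint k a)) ` c = c"
    using assms by (auto simp: carrier_rational_invariants)
  from c obtain p' q' where pq': "(p', q') \<in> R.fractions"
    "c = frac_rel (regular_ring k \<gg>) `` {(p', q')}" by (rule R.frac_field_cases)
  then obtain p q where p: "p \<in> poly_fun k" "p' = restrict p \<gg>"
    and q: "q \<in> poly_fun k" "q' = restrict q \<gg>"
    by (auto elim!: carrier_regular_ringE)
  have "\<exists>x \<in> \<gg>. q x \<noteq> 0" using pq'(1) unfolding q(2) using restrict_nonzero[of q \<gg>] by blast
  then obtain x\<^sub>1 where x1: "x\<^sub>1 \<in> \<gg>" "q x\<^sub>1 \<noteq> 0" by blast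
  have "(\<lambda>x. x $$ (0, 0)) \<in> poly_fun k" using k by (intro poly_fun.coord) auto
  from poly_fun_mult_nonzero[OF \<gg>_carrier \<gg>_line q(1) x1 this e_jet_lie]
  obtain x where x: "x \<in> \<gg>" "q x \<noteq> 0" "x $$ (0, 0) \<noteq> 0" using e_0_0 by auto
  \<comment> \<open>This \<open>a\<close> moves a point of the line to a point where the denominator
    \<open>q\<close> is nonzero, so the translated denominator \<open>Q\<close> does not vanish on
    all of the line.\<close>
  obtain a where a: "a \<in> carrier G" "adjoint k a (x $$ (0, 0) \<cdot>\<^sub>m e) = x"
    using orbit_slice[OF x(1,3)] by blast
  obtain P where P: "P \<in> poly_fun k" "\<And>x. x \<in> carrier_mat k k \<Longrightarrow> P x = p (adjoint k a x)"
    using poly_fun_adjoint[OF p(1) a(1)] by blast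
  obtain Q where Q: "Q \<in> poly_fun k" "\<And>x. x \<in> carrier_mat k k \<Longrightarrow> Q x = q (adjoint k a x)"
    using poly_fun_adjoint[OF q(1) a(1)] by blast
  have nz: "\<exists>x \<in> \<hh>. Q x \<noteq> 0"
    using x(2) a(2) e_carrier by (intro bexI[OF _ smult_e_\<hh>[of "x $$ (0, 0)"]]) (simp add: Q(2))
  \<comment> \<open>Invariance of \<open>p / q\<close>, written without division so that it holds
    also where denominators vanish.\<close>
  have cross: "p y * q (adjoint k b y) = p (adjoint k b y) * q y"
    if b: "b \<in> carrier G" and y: "y \<in> \<gg>" for b y
  proof -
    have "map_prod (pullback \<gg> (adjoint k b)) (pullback \<gg> (adjoint k b)) (p', q') \<in> c"
      using inv[OF b] R.frac_class_self[OF pq'(1)] unfolding pq'(2)[symmetric] by blast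
    then have "(pullback \<gg> (adjoint k b) p', pullback \<gg> (adjoint k b) q') \<in> c" by simp
    then have "p' \<otimes>\<^bsub>regular_ring k \<gg>\<^esub> pullback \<gg> (adjoint k b) q' =
        pullback \<gg> (adjoint k b) p' \<otimes>\<^bsub>regular_ring k \<gg>\<^esub> q'"
      unfolding pq'(2) R.mem_frac_class_iff[OF pq'(1)] by blast
    from fun_cong[OF this, of y] y adjoint_jet_lie(1)[OF k b y] show ?thesis
      by (simp add: pullback_def p(2) q(2))
  qed
  have "p y * slice_fun Q y = slice_fun P y * q y" if "y \<in> \<gg>" for y
  proof (rule eq_on_dense[OF _ _ _ that])
    show "(\<lambda>y. p y * slice_fun Q y) \<in> poly_fun k" "(\<lambda>y. slice_fun P y * q y) \<in> poly_fun k"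
      using p q P Q by (auto intro!: poly_fun.mult slice_fun_poly)
    fix y assume y: "y \<in> \<gg>" "y $$ (0, 0) \<noteq> 0"
    obtain d where d: "d \<in> carrier G" "adjoint k d (y $$ (0, 0) \<cdot>\<^sub>m e) = y"
      using orbit_slice[OF y] by blast
    \<comment> \<open>\<open>y\<close> and \<open>?z\<close> retract to the same point of the line,
      so they share an orbit: \<open>d\<close> times the inverse of \<open>a\<close> moves
      \<open>?z\<close> to \<open>y\<close>. Since \<open>P\<close> and \<open>Q\<close> at the line
      point are \<open>p\<close> and \<open>q\<close> at \<open>?z\<close>, the claim is
      \<open>cross\<close> at \<open>?z\<close>.\<close>
    let ?z = "adjoint k a (y $$ (0, 0) \<cdot>\<^sub>m e)"
    have z: "?z \<in> \<gg>" by (rule adjoint_jet_lie(1)[OF k a(1) smult_e_jet_lie])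
    have b: "d * inv\<^bsub>G\<^esub> a \<in> carrier G"
      using monoid.m_closed[OF group.is_monoid[OF group_jet_group] d(1) mat_jet_inv(1)[OF a(1)]] by simp
    have "adjoint k (d * inv\<^bsub>G\<^esub> a) ?z = adjoint k d (adjoint k (inv\<^bsub>G\<^esub> a) ?z)"
      by (rule adjoint_mult[OF d(1) mat_jet_inv(1)[OF a(1)] jet_lie_carrier[OF z]])
    also have "adjoint k (inv\<^bsub>G\<^esub> a) ?z = y $$ (0, 0) \<cdot>\<^sub>m e"
      using e_carrier by (intro adjoint_inverse(1)[OF a(1)]) simp
    also note d(2)
    finally have "p ?z * q y = p y * q ?z" using cross[OF b z] by simp
    then show "p y * slice_fun Q y = slice_fun P y * q y"
      using e_carrier by (simp add: slice_fun_def P(2) Q(2))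
  qed
  then have "c = slice_class P Q"
    unfolding pq'(2) R.frac_class_eq_iff[OF pq'(1) slice_fractions(1)[OF P(1) Q(1) nz]]
    by (auto simp: fun_eq_iff p(2) q(2))
  then show ?thesis using P(1) Q(1) nz by blast
qed

lemma weyl_invariants_rational:
  "rational_invariants k \<hh> W (weyl_action k) = frac_field (regular_ring k \<hh>)"
proof -
  have "map_prod (pullback \<hh> (weyl_action k w)) (pullback \<hh> (weyl_action k w)) ` c = c"
    if w: "w \<in> carrier W" and c: "c \<in> carrier (frac_field (regular_ring k \<hh>))" for w c
  proof -
    have id: "pullback \<hh> (weyl_action k w) f = f" if "f \<in> carrier (regular_ring k \<hh>)" for f
      using that w weyl_action_eq by (auto simp: pullback_def fun_eq_iff elim!: carrier_regular_ringE)
    have "c \<subseteq> S.fractions" by (rule S.frac_class_subset[OF c])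
    then have "map_prod (pullback \<hh> (weyl_action k w)) (pullback \<hh> (weyl_action k w)) z = z"
      if "z \<in> c" for z using that id by (cases z) auto
    then show ?thesis by (simp cong: image_cong)
  qed
  then have "{c \<in> carrier (frac_field (regular_ring k \<hh>)). \<forall>w \<in> carrier W.
      map_prod (pullback \<hh> (weyl_action k w)) (pullback \<hh> (weyl_action k w)) ` c = c} =
      carrier (frac_field (regular_ring k \<hh>))" by blast
  then show ?thesis by (simp add: rational_invariants_def rational_field_def)
qed

text \<open>Every invariant is a slice class, and on slice classes restriction is explicit. So the
  operations, injectivity and surjectivity reduce to fractions of polynomials on \<hh>.\<close>

lemma rational_restrict_iso:
  "rational_restrict k \<hh> \<in> ring_iso (rational_invariants k \<gg> G (adjoint k))
     (rational_invariants k \<hh> W (weyl_action k))"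
  unfolding weyl_invariants_rational ring_iso_def
proof (intro CollectI conjI ring_hom_memI)
  let ?A = "rational_invariants k \<gg> G (adjoint k)" and ?B = "frac_field (regular_ring k \<hh>)"
  note repr = rational_invariant_eq_slice_class
  note rr = rational_restrict_slice_class
  have ops: "c \<otimes>\<^bsub>?A\<^esub> d = c \<otimes>\<^bsub>frac_field (regular_ring k \<gg>)\<^esub> d"
    "c \<oplus>\<^bsub>?A\<^esub> d = c \<oplus>\<^bsub>frac_field (regular_ring k \<gg>)\<^esub> d"
    "\<one>\<^bsub>?A\<^esub> = \<one>\<^bsub>frac_field (regular_ring k \<gg>)\<^esub>" for c d
    by (simp_all add: rational_invariants_def rational_field_def)
  show maps: "rational_restrict k \<hh> c \<in> carrier ?B" if "c \<in> carrier ?A" for c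
  proof -
    from repr[OF that] obtain p q where
      pq: "p \<in> poly_fun k" "q \<in> poly_fun k" "\<exists>x \<in> \<hh>. q x \<noteq> 0" and c: "c = slice_class p q"
      by blast
    show ?thesis
      unfolding c rr[OF pq] by (rule S.frac_class_in_carrier[OF slice_fractions(2)[OF pq]])
  qed
  {
    fix c d assume "c \<in> carrier ?A" "d \<in> carrier ?A"
    from repr[OF this(1)] repr[OF this(2)] obtain p q r s where
      pq: "p \<in> poly_fun k" "q \<in> poly_fun k" "\<exists>x \<in> \<hh>. q x \<noteq> 0" and c: "c = slice_class p q" and
      rs: "r \<in> poly_fun k" "s \<in> poly_fun k" "\<exists>x \<in> \<hh>. s x \<noteq> 0" and d: "d = slice_class r s"
      by blast
    from pq(3) rs(3) obtain x y where "x \<in> \<hh>" "q x \<noteq> 0" "y \<in> \<hh>" "s y \<noteq> 0" by blast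
    \<comment> \<open>To restrict a product or a sum, the common denominator must be nonzero
      somewhere on \<hh>; irreducibility of the line supplies such a point.\<close>
    from poly_fun_mult_nonzero[OF subset_trans[OF \<hh>_subset \<gg>_carrier] \<hh>_line pq(2) this(1,2) rs(2) this(3,4)]
    have qs: "\<exists>x \<in> \<hh>. q x * s x \<noteq> 0" by auto
    note frR = slice_fractions(1)[OF pq] slice_fractions(1)[OF rs]
    note frS = slice_fractions(2)[OF pq] slice_fractions(2)[OF rs]
    have prod: "c \<otimes>\<^bsub>?A\<^esub> d = slice_class (\<lambda>x. p x * r x) (\<lambda>x. q x * s x)"
      unfolding c d ops R.frac_class_mult[OF frR]
      by (rule arg_cong[where f = "\<lambda>z. _ `` {z}"]) (auto simp: fun_eq_iff slice_fun_def)
    have "rational_restrict k \<hh> (c \<otimes>\<^bsub>?A\<^esub> d) = frac_rel (regular_ring k \<hh>) ``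
        {(restrict (\<lambda>x. p x * r x) \<hh>, restrict (\<lambda>x. q x * s x) \<hh>)}"
      unfolding prod using pq rs qs by (intro rr poly_fun.mult)
    also have "\<dots> = rational_restrict k \<hh> c \<otimes>\<^bsub>?B\<^esub> rational_restrict k \<hh> d"
      unfolding c d rr[OF pq] rr[OF rs] S.frac_class_mult[OF frS]
      by (rule arg_cong[where f = "\<lambda>z. _ `` {z}"]) (auto simp: fun_eq_iff)
    finally show "rational_restrict k \<hh> (c \<otimes>\<^bsub>?A\<^esub> d) =
        rational_restrict k \<hh> c \<otimes>\<^bsub>?B\<^esub> rational_restrict k \<hh> d" .
    have sum: "c \<oplus>\<^bsub>?A\<^esub> d = slice_class (\<lambda>x. p x * s x + r x * q x) (\<lambda>x. q x * s x)"
      unfolding c d ops R.frac_class_add[OF frR]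
      by (rule arg_cong[where f = "\<lambda>z. _ `` {z}"]) (auto simp: fun_eq_iff slice_fun_def)
    have "rational_restrict k \<hh> (c \<oplus>\<^bsub>?A\<^esub> d) = frac_rel (regular_ring k \<hh>) ``
        {(restrict (\<lambda>x. p x * s x + r x * q x) \<hh>, restrict (\<lambda>x. q x * s x) \<hh>)}"
      unfolding sum using pq rs qs by (intro rr poly_fun.mult poly_fun.add)
    also have "\<dots> = rational_restrict k \<hh> c \<oplus>\<^bsub>?B\<^esub> rational_restrict k \<hh> d"
      unfolding c d rr[OF pq] rr[OF rs] S.frac_class_add[OF frS]
      by (rule arg_cong[where f = "\<lambda>z. _ `` {z}"]) (auto simp: fun_eq_iff)
    finally show "rational_restrict k \<hh> (c \<oplus>\<^bsub>?A\<^esub> d) =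
        rational_restrict k \<hh> c \<oplus>\<^bsub>?B\<^esub> rational_restrict k \<hh> d" .
  }
  have one: "(\<lambda>x. 1) \<in> poly_fun k" "\<exists>x \<in> \<hh>. (1 :: complex) \<noteq> 0"
    using poly_fun.const smult_e_\<hh> by auto
  have "\<one>\<^bsub>?A\<^esub> = slice_class (\<lambda>x. 1) (\<lambda>x. 1)"
    unfolding ops frac_field_simps by (simp add: slice_fun_def cong: restrict_cong)
  then show "rational_restrict k \<hh> \<one>\<^bsub>?A\<^esub> = \<one>\<^bsub>?B\<^esub>"
    using rr[OF one(1,1,2)] by (simp add: frac_field_simps)
  show "bij_betw (rational_restrict k \<hh>) (carrier ?A) (carrier ?B)"
  proof (rule bij_betw_imageI, rule inj_onI)
    fix c d assume cA: "c \<in> carrier ?A" and dA: "d \<in> carrier ?A"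
      and eq: "rational_restrict k \<hh> c = rational_restrict k \<hh> d"
    from repr[OF cA] repr[OF dA] obtain p q r s where
      pq: "p \<in> poly_fun k" "q \<in> poly_fun k" "\<exists>x \<in> \<hh>. q x \<noteq> 0" and c: "c = slice_class p q" and
      rs: "r \<in> poly_fun k" "s \<in> poly_fun k" "\<exists>x \<in> \<hh>. s x \<noteq> 0" and d: "d = slice_class r s"
      by blast
    show "c = d"
      using eq unfolding c d rr[OF pq] rr[OF rs] by (rule iffD2[OF slice_class_eq_iff[OF pq rs]])
  next
    have "c \<in> rational_restrict k \<hh> ` carrier ?A" if "c \<in> carrier ?B" for c
    proof -
      from that obtain p' q' where pq': "(p', q') \<in> S.fractions"
        "c = frac_rel (regular_ring k \<hh>) `` {(p', q')}" by (rule S.frac_field_cases)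
      then obtain p q where p: "p \<in> poly_fun k" "p' = restrict p \<hh>"
        and q: "q \<in> poly_fun k" "q' = restrict q \<hh>"
        by (auto elim!: carrier_regular_ringE)
      have nz: "\<exists>x \<in> \<hh>. q x \<noteq> 0" using pq'(1) unfolding q(2) using restrict_nonzero[of q \<hh>] by blast
      have "c = rational_restrict k \<hh> (slice_class p q)"
        unfolding pq'(2) p(2) q(2) by (rule rr[symmetric, OF p(1) q(1) nz])
      then show ?thesis
        using slice_class_invariant[OF p(1) q(1) nz] by blast
    qed
    then show "rational_restrict k \<hh> ` carrier ?A = carrier ?B"
      by (intro equalityI subsetI image_subsetI) (auto intro: maps)
  qed
qed

end

text \<open>The first conjunct certifies the action itself: \<open>weyl_action\<close> is meaningful
  only if all representatives of a coset agree, and the pullback of functions on \<hh> only if \<hh>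
  is preserved.\<close>

theorem theorem4p2:
  fixes k :: nat and H :: "complex mat set"
  assumes "1 \<le> k"
    and "generic_stabilizer k H"
  defines "G \<equiv> jet_group k"
    and "\<gg> \<equiv> jet_lie k"
    and "\<hh> \<equiv> lie_algebra k H"
    and "W \<equiv> weyl_group k H"
  shows "(\<forall>w \<in> carrier W. \<forall>n \<in> w. \<forall>x \<in> \<hh>. adjoint k n x \<in> \<hh> \<and> weyl_action k w x = adjoint k n x)
    \<and> rational_restrict k \<hh> \<in> ring_iso (rational_invariants k \<gg> G (adjoint k))
                                       (rational_invariants k \<hh> W (weyl_action k))
    \<and> finite (carrier W)
    \<and> regular_restrict \<hh> \<in> ring_iso (regular_invariants k \<gg> G (adjoint k))
                                    (regular_invariants k \<hh> W (weyl_action k))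
    \<and> finitely_generated_algebra (constants \<gg>) (regular_invariants k \<gg> G (adjoint k))"
proof -
  obtain g\<^sub>0 where g\<^sub>0: "g\<^sub>0 \<in> carrier (jet_group k)"
    and H: "H = stabilizer (jet_group k) (adjoint k) (adjoint k g\<^sub>0 (vfield k fps_X))"
    using generic_stabilizer_eq[OF assms(1,2)] by blast
  interpret J: jet_slice k g\<^sub>0 by unfold_locales (use assms(1) g\<^sub>0 in auto)
  have JH: "J.H = H" unfolding J.H_def J.e_def H ..
  have "adjoint k n x \<in> \<hh> \<and> weyl_action k w x = adjoint k n x"
    if "w \<in> carrier W" "n \<in> w" "x \<in> \<hh>" for w n x
  proof -
    have "w = H" using that(1) J.carrier_weyl_group unfolding JH W_def by blast
    then show ?thesis
      using that J.adjoint_H_fixes J.weyl_action_eq unfolding JH W_def \<hh>_def by simp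
  qed
  moreover have "finite (carrier W)"
    using finite_subset[OF J.carrier_weyl_group] unfolding JH W_def by simp
  ultimately show ?thesis
    using J.rational_restrict_iso J.regular_restrict_iso J.finitely_generated_invariants
    unfolding JH G_def \<gg>_def \<hh>_def W_def by blast
qed

end
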